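(* Let $A=(A_1,\ldots,A_s)\in\mathbb{R}^{m\times n}$, with $A_k\in\mathbb{R}^{m\times p}$ and $n=sp\le m$, be of full column rank. Let $\hat Q_k$, $R_k$ be the matrices computed by $k$ steps of the algorithm BCGS2 in floating point arithmetic with machine unit $\varepsilon_M$ (see context), let $R_{kk}$ be the computed $k$-th diagonal block and $R_2^{(k)}$ the upper triangular factor produced by the second call to block_CGS_step in the $k$-th step, and let $t_k=kp$. Define $$\alpha=\sqrt{7+4\sqrt2},\qquad \gamma_k=\left(\alpha^2(k-1)+1\right)^{-1/2},\qquad f_1(m,t_{k-1},p)=\gamma_k^{-1}L_F(m,t_{k-1},p),$$ $$f_{sing}(m,t_{k-1},p)=f_1(m,t_{k-1},p)+L_F(m,t_{k-1},p)+\gamma_kL_5(p),$$ where $L_F(m,t,p)=L_1(m,p)+L_2(m,t,p)+L_3(t,p)$. Assume that either $$\varepsilon_M f_{sing}(m,t_{k-1},p)\,\|A_k\|_2\,\|R_{kk}^{-1}\|_2\le\gamma_k,\qquad k=2,\ldots,s,$$ or $$\|[R_2^{(k)}]^{-1}\|_2\le(1+\gamma_k^2)^{1/2},\qquad k=2,\ldots,s.$$ Then for $k=1,\ldots,s$, $$\|I_{t_k}-\hat Q_k^T\hat Q_k\|_2\le\varepsilon_Mf_1(m,t_{k-1},p)+\mathcal{O}(\varepsilon_M^2).$$ In particular, for $k=s$ and $Q=\hat Q_s$, $\|I_n-Q^TQ\|_2\le\varepsilon_Mf_1(m,t_{s-1},p)+\mathcal{O}(\varepsilon_M^2)$.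
   Context: $\mathcal{O}(\varepsilon_M^j)$ denotes a quantity bounded by $C\varepsilon_M^j$ for all sufficiently small $\varepsilon_M>0$, with $C$ independent of $\varepsilon_M$ (it may depend on the dimensions and the input matrices). $L_1(m,p),L_2(m,t,p),L_3(t,p),L_4(p),L_5(p)$ are fixed positive ("modestly growing") functions, nondecreasing in all their arguments ($L_2,L_3$ are nonnegative at $t=0$). It is assumed that $\varepsilon_Mf_1(m,t_{k-1},p)<1$ for $k=1,\ldots,s$. The stated inequalities involving an inverse include the assumption that the inverse exists. Routine local_qr: for $B\in\mathbb{R}^{m\times p}$, $p\le m$, the computed output $[Q,R]=\mathrm{local\_qr}(B)$ consists of $Q\in\mathbb{R}^{m\times p}$ and upper triangular $R\in\mathbb{R}^{p\times p}$ with $\|I_p-Q^TQ\|_2\le\varepsilon_ML_1(m,p)<1$ and $\|B-QR\|_2\le\varepsilon_ML_1(m,p)\|B\|_2$. Routine block_CGS_step$(U,B)$, for $U\in\mathbb{R}^{m\times t}$, $B\in\mathbb{R}^{m\times p}$, $t+p\le n\le m$: compute $\bar S=U^TB$; $\bar Y=B-U\bar S$; $[\bar Q,\bar R]=\mathrm{local\_qr}(\bar Y)$; return $\bar Q,\bar R,\bar S$. In floating point arithmetic, whenever $\|I_t-U^TU\|_2\le\varepsilon_Mf_1(m,t,p)+\mathcal{O}(\varepsilon_M^2)<1$, the computed quantities satisfy $\|I_p-\bar Q^T\bar Q\|_2\le\varepsilon_ML_1(m,p)$; $\bar Q\bar R=\bar Y+\Delta\bar Y$, $\|\Delta\bar Y\|_2\le\varepsilon_ML_1(m,p)\|B\|_2$;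 $\bar S+\delta\bar S=U^TB$, $\|\delta\bar S\|_2\le\varepsilon_ML_2(m,t,p)\|B\|_2+\mathcal{O}(\varepsilon_M^2)$; $\bar Y+\delta\bar Y=B-U\bar S$, $\|\delta\bar Y\|_2\le\varepsilon_ML_3(t,p)\|B\|_2+\mathcal{O}(\varepsilon_M^2)$. Routine block_CGS2_step$(U,B)$: $[Q_1',R_1',S_1']=\mathrm{block\_CGS\_step}(U,B)$; $[Q_B,R_2',S_2']=\mathrm{block\_CGS\_step}(U,Q_1')$; $S_B=S_1'+S_2'R_1'$; $R_B=R_2'R_1'$; return $Q_B,R_B,S_B$. The computed $S_B,R_B$ satisfy $S_B+\delta S_B=S_1'+S_2'R_1'$, $\|\delta S_B\|_2\le\varepsilon_ML_4(p)\|B\|_2$, and $R_B+\delta R_B=R_2'R_1'$, $\|\delta R_B\|_2\le\varepsilon_ML_5(p)\|B\|_2$. Algorithm BCGS2: $[Q_1,R_{11}]=\mathrm{local\_qr}(A_1)$, $\hat Q_1=Q_1$, $R_1=R_{11}$. The $k$-th step, $k=2,\ldots,s$: $[Q_k,R_{kk},S_k]=\mathrm{block\_CGS2\_step}(\hat Q_{k-1},A_k)$, $\hat Q_k=(\hat Q_{k-1},\,Q_k)$, $R_k=\begin{pmatrix}R_{k-1}&S_k\\0&R_{kk}\end{pmatrix}$. The matrix $R_2^{(k)}$ is the factor $R_2'$ computed inside this $k$-th step. *)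

theory Defs
  imports
    Complex_Main
    "Jordan_Normal_Form.Gauss_Jordan_Elimination"
    "Jordan_Normal_Form.DL_Rank"
begin

text \<open>The operator 2-norm. The supremum is taken over the closed unit ball rather than the unit
  sphere, so that the norm of a matrix without columns is 0.\<close>

definition norm2 :: "real mat \<Rightarrow> real" where
  "norm2 A = (SUP x \<in> {x \<in> carrier_vec (dim_col A). x \<bullet> x \<le> 1}. sqrt ((A *\<^sub>v x) \<bullet> (A *\<^sub>v x)))"

definition hcat :: "real mat \<Rightarrow> real mat \<Rightarrow> real mat" where
  "hcat A B = four_block_mat A B (0\<^sub>m 0 (dim_col A)) (0\<^sub>m 0 (dim_col B))"

text \<open>The block $A_k$ of $A = (A_1,\ldots,A_s)$; blocks are numbered from 1 and have $p$ columns.\<close>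

definition col_block :: "nat \<Rightarrow> real mat \<Rightarrow> nat \<Rightarrow> real mat" where
  "col_block p A k = mat (dim_row A) p (\<lambda>(i, j). A $$ (i, (k - 1) * p + j))"

definition orth_defect :: "real mat \<Rightarrow> real" where
  "orth_defect Q = norm2 (1\<^sub>m (dim_col Q) - Q\<^sup>T * Q)"

text \<open>The elementary computations, as carried out in one floating point arithmetic:
  local_qr, and the computed values of $U^T B$, of $B - U S$, of $S_1 + S_2 R_1$ and
  of $R_2 R_1$ (arguments in this order: \<open>U B\<close>, \<open>U B S\<close>, \<open>S1 S2 R1\<close>, \<open>R2 R1\<close>).
  Only their error bounds, stated further below, are known.\<close>

record fp_arith =
  fl_local_qr :: "real mat \<Rightarrow> real mat \<times> real mat"
  fl_trans_mult :: "real mat \<Rightarrow> real mat \<Rightarrow> real mat"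
  fl_residual :: "real mat \<Rightarrow> real mat \<Rightarrow> real mat \<Rightarrow> real mat"
  fl_comb_S :: "real mat \<Rightarrow> real mat \<Rightarrow> real mat \<Rightarrow> real mat"
  fl_comb_R :: "real mat \<Rightarrow> real mat \<Rightarrow> real mat"

definition block_CGS_step ::
    "fp_arith \<Rightarrow> real mat \<Rightarrow> real mat \<Rightarrow> real mat \<times> real mat \<times> real mat" where
  "block_CGS_step a U B =
    (let S = fl_trans_mult a U B;
         Y = fl_residual a U B S;
         (Q, R) = fl_local_qr a Y
     in (Q, R, S))"

definition first_CGS_step ::
    "fp_arith \<Rightarrow> real mat \<Rightarrow> real mat \<Rightarrow> real mat \<times> real mat \<times> real mat" where
  "first_CGS_step a U B = block_CGS_step a U B"

definition second_CGS_step ::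
    "fp_arith \<Rightarrow> real mat \<Rightarrow> real mat \<Rightarrow> real mat \<times> real mat \<times> real mat" where
  "second_CGS_step a U B = (case first_CGS_step a U B of (Q1, R1, S1) \<Rightarrow> block_CGS_step a U Q1)"

definition block_CGS2_step ::
    "fp_arith \<Rightarrow> real mat \<Rightarrow> real mat \<Rightarrow> real mat \<times> real mat \<times> real mat" where
  "block_CGS2_step a U B =
    (let (Q1, R1, S1) = first_CGS_step a U B;
         (QB, R2, S2) = second_CGS_step a U B;
         SB = fl_comb_S a S1 S2 R1;
         RB = fl_comb_R a R2 R1
     in (QB, RB, SB))"

text \<open>The pair $(\hat Q_k, R_k)$ after $k$ steps; the value at $k = 0$ is only a convention.\<close>

fun BCGS2 :: "fp_arith \<Rightarrow> nat \<Rightarrow> real mat \<Rightarrow> nat \<Rightarrow> real mat \<times> real mat" where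
  "BCGS2 a p A 0 = (0\<^sub>m (dim_row A) 0, 0\<^sub>m 0 0)"
| "BCGS2 a p A (Suc 0) = fl_local_qr a (col_block p A 1)"
| "BCGS2 a p A (Suc (Suc k)) =
    (let (Qh, R) = BCGS2 a p A (Suc k);
         (Q, Rkk, S) = block_CGS2_step a Qh (col_block p A (Suc (Suc k)))
     in (hcat Qh Q, four_block_mat R S (0\<^sub>m (dim_row Rkk) (dim_col R)) Rkk))"

definition Qhat :: "fp_arith \<Rightarrow> nat \<Rightarrow> real mat \<Rightarrow> nat \<Rightarrow> real mat" where
  "Qhat a p A k = fst (BCGS2 a p A k)"

text \<open>For $k \ge 2$: the diagonal block $R_{kk}$ and the factor $R_2^{(k)}$.\<close>

definition Rkk :: "fp_arith \<Rightarrow> nat \<Rightarrow> real mat \<Rightarrow> nat \<Rightarrow> real mat" where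
  "Rkk a p A k = (case block_CGS2_step a (Qhat a p A (k - 1)) (col_block p A k) of
     (Q, R, S) \<Rightarrow> R)"

definition R2k :: "fp_arith \<Rightarrow> nat \<Rightarrow> real mat \<Rightarrow> nat \<Rightarrow> real mat" where
  "R2k a p A k = (case second_CGS_step a (Qhat a p A (k - 1)) (col_block p A k) of
     (Q, R, S) \<Rightarrow> R)"

definition bcgs_alpha :: real where
  "bcgs_alpha = sqrt (7 + 4 * sqrt 2)"

definition bcgs_gamma :: "nat \<Rightarrow> real" where
  "bcgs_gamma k = (bcgs_alpha ^ 2 * (real k - 1) + 1) powr (- 1 / 2)"

definition L_F :: "(nat \<Rightarrow> nat \<Rightarrow> real) \<Rightarrow> (nat \<Rightarrow> nat \<Rightarrow> nat \<Rightarrow> real) \<Rightarrow> (nat \<Rightarrow> nat \<Rightarrow> real)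
    \<Rightarrow> nat \<Rightarrow> nat \<Rightarrow> nat \<Rightarrow> real" where
  "L_F L1 L2 L3 m t p = L1 m p + L2 m t p + L3 t p"

text \<open>\<open>f_1\<close> and \<open>f_sing\<close> are used only at $t = t_{k-1} = (k-1)p$,
  where \<open>t div p + 1\<close> is $k$.\<close>

definition f_1 :: "(nat \<Rightarrow> nat \<Rightarrow> real) \<Rightarrow> (nat \<Rightarrow> nat \<Rightarrow> nat \<Rightarrow> real) \<Rightarrow> (nat \<Rightarrow> nat \<Rightarrow> real)
    \<Rightarrow> nat \<Rightarrow> nat \<Rightarrow> nat \<Rightarrow> real" where
  "f_1 L1 L2 L3 m t p = inverse (bcgs_gamma (t div p + 1)) * L_F L1 L2 L3 m t p"

definition f_sing :: "(nat \<Rightarrow> nat \<Rightarrow> real) \<Rightarrow> (nat \<Rightarrow> nat \<Rightarrow> nat \<Rightarrow> real) \<Rightarrow> (nat \<Rightarrow> nat \<Rightarrow> real)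
    \<Rightarrow> (nat \<Rightarrow> real) \<Rightarrow> nat \<Rightarrow> nat \<Rightarrow> nat \<Rightarrow> real" where
  "f_sing L1 L2 L3 L5 m t p =
     f_1 L1 L2 L3 m t p + L_F L1 L2 L3 m t p + bcgs_gamma (t div p + 1) * L5 p"

definition growth_functions :: "(nat \<Rightarrow> nat \<Rightarrow> real) \<Rightarrow> (nat \<Rightarrow> nat \<Rightarrow> nat \<Rightarrow> real)
    \<Rightarrow> (nat \<Rightarrow> nat \<Rightarrow> real) \<Rightarrow> (nat \<Rightarrow> real) \<Rightarrow> (nat \<Rightarrow> real) \<Rightarrow> bool" where
  "growth_functions L1 L2 L3 L4 L5 \<longleftrightarrow>
    (\<forall>m\<ge>1. \<forall>p\<ge>1. 0 < L1 m p \<and> 0 \<le> L2 m 0 p \<and> 0 \<le> L3 0 p \<and> 0 < L4 p \<and> 0 < L5 p) \<and>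
    (\<forall>m\<ge>1. \<forall>t\<ge>1. \<forall>p\<ge>1. 0 < L2 m t p \<and> 0 < L3 t p) \<and>
    (\<forall>m m' t t' p p'. 1 \<le> m \<and> m \<le> m' \<and> t \<le> t' \<and> 1 \<le> p \<and> p \<le> p' \<longrightarrow>
      L1 m p \<le> L1 m' p' \<and> L2 m t p \<le> L2 m' t' p' \<and> L3 t p \<le> L3 t' p' \<and>
      L4 p \<le> L4 p' \<and> L5 p \<le> L5 p')"

text \<open>A family \<open>a\<close> of arithmetics is indexed by the machine unit \<open>\<epsilon>\<close>. A term $O(\epsilon^2)$ is
  rendered as \<open>C * \<epsilon>\<^sup>2\<close> with \<open>C\<close> chosen independently of \<open>\<epsilon>\<close>, and the bound is required for
  \<open>\<forall>\<^sub>F \<epsilon> in at_right 0\<close>, i.e. for all sufficiently small positive \<open>\<epsilon>\<close>.\<close>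

definition dims_ok :: "fp_arith \<Rightarrow> nat \<Rightarrow> nat \<Rightarrow> bool" where
  "dims_ok a m p \<longleftrightarrow>
    (\<forall>B \<in> carrier_mat m p. case fl_local_qr a B of (Q, R) \<Rightarrow>
        Q \<in> carrier_mat m p \<and> R \<in> carrier_mat p p) \<and>
    (\<forall>t. \<forall>U \<in> carrier_mat m t. \<forall>B \<in> carrier_mat m p.
        fl_trans_mult a U B \<in> carrier_mat t p \<and>
        (\<forall>S \<in> carrier_mat t p. fl_residual a U B S \<in> carrier_mat m p)) \<and>
    (\<forall>t. \<forall>S1 \<in> carrier_mat t p. \<forall>S2 \<in> carrier_mat t p. \<forall>R1 \<in> carrier_mat p p.
        fl_comb_S a S1 S2 R1 \<in> carrier_mat t p) \<and>
    (\<forall>R2 \<in> carrier_mat p p. \<forall>R1 \<in> carrier_mat p p. fl_comb_R a R2 R1 \<in> carrier_mat p p)"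

definition local_qr_accurate :: "(nat \<Rightarrow> nat \<Rightarrow> real) \<Rightarrow> nat \<Rightarrow> nat \<Rightarrow> real \<Rightarrow> fp_arith \<Rightarrow> bool" where
  "local_qr_accurate L1 m p \<epsilon> a \<longleftrightarrow>
    (\<forall>B \<in> carrier_mat m p. case fl_local_qr a B of (Q, R) \<Rightarrow>
       upper_triangular R \<and>
       orth_defect Q \<le> \<epsilon> * L1 m p \<and> \<epsilon> * L1 m p < 1 \<and>
       norm2 (B - Q * R) \<le> \<epsilon> * L1 m p * norm2 B)"

text \<open>The bounds for one call \<open>block_CGS_step a U B\<close>, with \<open>D * \<epsilon>\<^sup>2\<close> in place of the
  $O(\epsilon^2)$ terms. Each backward error ($\Delta\bar Y$, $\delta\bar S$, $\delta\bar Y$) is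
  determined by its defining equation and is written out as the corresponding difference.\<close>

definition block_CGS_step_bounds ::
    "(nat \<Rightarrow> nat \<Rightarrow> real) \<Rightarrow> (nat \<Rightarrow> nat \<Rightarrow> nat \<Rightarrow> real) \<Rightarrow> (nat \<Rightarrow> nat \<Rightarrow> real)
     \<Rightarrow> nat \<Rightarrow> nat \<Rightarrow> nat \<Rightarrow> real \<Rightarrow> real \<Rightarrow> fp_arith \<Rightarrow> real mat \<Rightarrow> real mat \<Rightarrow> bool" where
  "block_CGS_step_bounds L1 L2 L3 m t p D \<epsilon> a U B \<longleftrightarrow>
    (case block_CGS_step a U B of (Q, R, S) \<Rightarrow>
      let Y = fl_residual a U B S in
       orth_defect Q \<le> \<epsilon> * L1 m p \<and>
       norm2 (Q * R - Y) \<le> \<epsilon> * L1 m p * norm2 B \<and>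
       norm2 (U\<^sup>T * B - S) \<le> \<epsilon> * L2 m t p * norm2 B + D * \<epsilon>\<^sup>2 \<and>
       norm2 (B - U * S - Y) \<le> \<epsilon> * L3 t p * norm2 B + D * \<epsilon>\<^sup>2)"

text \<open>The error contract for a call of block_CGS_step whose arguments depend on \<open>\<epsilon>\<close>: for every
  implied constant \<open>C\<close> in the orthogonality condition there is an implied constant \<open>D\<close>
  for the computed quantities.\<close>

definition block_CGS_step_accurate ::
    "(nat \<Rightarrow> nat \<Rightarrow> real) \<Rightarrow> (nat \<Rightarrow> nat \<Rightarrow> nat \<Rightarrow> real) \<Rightarrow> (nat \<Rightarrow> nat \<Rightarrow> real)
     \<Rightarrow> nat \<Rightarrow> nat \<Rightarrow> nat \<Rightarrow> (real \<Rightarrow> fp_arith) \<Rightarrow> (real \<Rightarrow> real mat) \<Rightarrow> (real \<Rightarrow> real mat) \<Rightarrow> bool" where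
  "block_CGS_step_accurate L1 L2 L3 m t p a U B \<longleftrightarrow>
    (\<forall>C. \<exists>D. \<forall>\<^sub>F \<epsilon> in at_right 0.
       orth_defect (U \<epsilon>) \<le> \<epsilon> * f_1 L1 L2 L3 m t p + C * \<epsilon>\<^sup>2 \<and>
       \<epsilon> * f_1 L1 L2 L3 m t p + C * \<epsilon>\<^sup>2 < 1 \<longrightarrow>
       block_CGS_step_bounds L1 L2 L3 m t p D \<epsilon> (a \<epsilon>) (U \<epsilon>) (B \<epsilon>))"

definition block_CGS2_step_bounds ::
    "(nat \<Rightarrow> real) \<Rightarrow> (nat \<Rightarrow> real) \<Rightarrow> nat \<Rightarrow> real \<Rightarrow> fp_arith \<Rightarrow> real mat \<Rightarrow> real mat \<Rightarrow> bool" where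
  "block_CGS2_step_bounds L4 L5 p \<epsilon> a U B \<longleftrightarrow>
    (case first_CGS_step a U B of (Q1, R1, S1) \<Rightarrow>
     case second_CGS_step a U B of (Q2, R2, S2) \<Rightarrow>
     case block_CGS2_step a U B of (QB, RB, SB) \<Rightarrow>
       norm2 (S1 + S2 * R1 - SB) \<le> \<epsilon> * L4 p * norm2 B \<and>
       norm2 (R2 * R1 - RB) \<le> \<epsilon> * L5 p * norm2 B)"

text \<open>The error model for the run of BCGS2 on the fixed matrix \<open>A\<close>. The contracts of the
  block routines are imposed on the calls made in this run, so that their implied
  constants may depend on the input.\<close>

definition BCGS2_error_model ::
    "(nat \<Rightarrow> nat \<Rightarrow> real) \<Rightarrow> (nat \<Rightarrow> nat \<Rightarrow> nat \<Rightarrow> real) \<Rightarrow> (nat \<Rightarrow> nat \<Rightarrow> real)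
     \<Rightarrow> (nat \<Rightarrow> real) \<Rightarrow> (nat \<Rightarrow> real) \<Rightarrow> nat \<Rightarrow> nat \<Rightarrow> nat \<Rightarrow> real mat \<Rightarrow> (real \<Rightarrow> fp_arith) \<Rightarrow> bool" where
  "BCGS2_error_model L1 L2 L3 L4 L5 m p s A a \<longleftrightarrow>
    (\<forall>\<^sub>F \<epsilon> in at_right 0. dims_ok (a \<epsilon>) m p \<and> local_qr_accurate L1 m p \<epsilon> (a \<epsilon>)) \<and>
    (\<forall>k \<in> {2..s}.
      let t = (k - 1) * p; U = (\<lambda>\<epsilon>. Qhat (a \<epsilon>) p A (k - 1)); B = col_block p A k in
        block_CGS_step_accurate L1 L2 L3 m t p a U (\<lambda>\<epsilon>. B) \<and>
        block_CGS_step_accurate L1 L2 L3 m t p a U (\<lambda>\<epsilon>. fst (first_CGS_step (a \<epsilon>) (U \<epsilon>) B)) \<and>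
        (\<forall>\<^sub>F \<epsilon> in at_right 0. block_CGS2_step_bounds L4 L5 p \<epsilon> (a \<epsilon>) (U \<epsilon>) B))"

definition R_diag_condition ::
    "(nat \<Rightarrow> nat \<Rightarrow> real) \<Rightarrow> (nat \<Rightarrow> nat \<Rightarrow> nat \<Rightarrow> real) \<Rightarrow> (nat \<Rightarrow> nat \<Rightarrow> real)
     \<Rightarrow> (nat \<Rightarrow> real) \<Rightarrow> nat \<Rightarrow> nat \<Rightarrow> real mat \<Rightarrow> real \<Rightarrow> fp_arith \<Rightarrow> nat \<Rightarrow> bool" where
  "R_diag_condition L1 L2 L3 L5 m p A \<epsilon> a k \<longleftrightarrow>
    (\<exists>X. mat_inverse (Rkk a p A k) = Some X \<and>
      \<epsilon> * f_sing L1 L2 L3 L5 m ((k - 1) * p) p * norm2 (col_block p A k) * norm2 X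
        \<le> bcgs_gamma k)"

definition R2_condition :: "nat \<Rightarrow> real mat \<Rightarrow> fp_arith \<Rightarrow> nat \<Rightarrow> bool" where
  "R2_condition p A a k \<longleftrightarrow>
    (\<exists>X. mat_inverse (R2k a p A k) = Some X \<and> norm2 X \<le> (1 + (bcgs_gamma k)\<^sup>2) powr (1 / 2))"

end

theory Submission
  imports Defs "HOL-Analysis.L2_Norm"
begin

text \<open>Write \<open>U\<close> for the nearly orthonormal factor accumulated before step \<open>k\<close> and \<open>W = U\<^sup>T Q1\<close>, where
  \<open>Q1, R1\<close> and \<open>Q, R2\<close> come from the two passes. Since \<open>Q R2 = (I - U U\<^sup>T) Q1 + O(\<epsilon>)\<close>, Pythagoras
  gives \<open>\<parallel>R2 v\<parallel>\<^sup>2 + \<parallel>W v\<parallel>\<^sup>2 = (1 + O(\<epsilon>)) \<parallel>v\<parallel>\<^sup>2\<close>; hence a bound on the inverse of \<open>R2\<close> amounts to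
  a bound on \<open>\<parallel>W v\<parallel> / \<parallel>R2 v\<parallel>\<close>, and the condition on \<open>R\<^sub>k\<^sub>k\<close> (which is nearly \<open>R2 R1\<close>) yields the same
  bound through \<open>W R1 = O(\<epsilon>)\<close>. Multiplying by \<open>U\<^sup>T\<close>,
  \<open>U\<^sup>T Q R2 = (I - U\<^sup>T U) W + U\<^sup>T E\<close> with a rounding error \<open>E\<close>, so
  \<open>\<parallel>U\<^sup>T Q\<parallel> \<le> \<epsilon> (1 + sqrt 2) L_F\<close>, and the defects of \<open>U\<close> and \<open>Q\<close> combine with this
  off-diagonal block like a Frobenius norm. There is enough room in \<open>1 + sqrt 2\<close> and in
  \<open>\<gamma>\<^sub>k < \<gamma>\<^sub>k\<^sub>-\<^sub>1\<close> to absorb all second-order terms, so the bound holds with \<open>C = 0\<close>.\<close>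

subsection \<open>The run of BCGS2\<close>

lemma Qhat_1: "Qhat a p A (Suc 0) = fst (fl_local_qr a (col_block p A 1))"
  by (simp add: Qhat_def)

text \<open>\<open>second_CGS_step\<close> and \<open>block_CGS2_step\<close> rerun the first pass
  on the same arguments, so the results of the two passes determine everything that step
  \<open>i + 2\<close> contributes to the theorem and its hypotheses.\<close>

lemma BCGS2_Suc_factors:
  assumes "first_CGS_step a (Qhat a p A (Suc i)) (col_block p A (Suc (Suc i))) = (Q1, R1, S1)"
    and "block_CGS_step a (Qhat a p A (Suc i)) Q1 = (Q, R2, S2)"
  shows "Qhat a p A (Suc (Suc i)) = hcat (Qhat a p A (Suc i)) Q"
    and "R2k a p A (Suc (Suc i)) = R2"
    and "Rkk a p A (Suc (Suc i)) = fl_comb_R a R2 R1"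
  using assms
  by (auto simp: Qhat_def R2k_def Rkk_def block_CGS2_step_def second_CGS_step_def Let_def
      split: prod.splits)

subsection \<open>Euclidean norm and operator norm\<close>

definition vnorm :: "real vec \<Rightarrow> real" where
  "vnorm v = sqrt (v \<bullet> v)"

text \<open>Transfers the triangle and Cauchy-Schwarz inequalities from \<open>L2_set\<close> to
  vectors.\<close>

lemma vnorm_L2_set: "vnorm v = L2_set (\<lambda>i. v $ i) {0..<dim_vec v}"
  by (simp add: vnorm_def L2_set_def scalar_prod_def power2_eq_square)

lemma vnorm_nonneg [simp]: "0 \<le> vnorm v"
  by (simp add: vnorm_L2_set L2_set_nonneg)

lemma scalar_prod_self_nonneg [simp]: "0 \<le> v \<bullet> (v :: real vec)"
  by (simp add: scalar_prod_def sum_nonneg)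

lemma vnorm_power2: "(vnorm v)\<^sup>2 = v \<bullet> v"
  by (simp add: vnorm_def)

lemma vnorm_zero_vec [simp]: "vnorm (0\<^sub>v n) = 0"
  by (simp add: vnorm_def)

lemma vnorm_eq_0_iff:
  assumes "v \<in> carrier_vec n"
  shows "vnorm v = 0 \<longleftrightarrow> v = 0\<^sub>v n"
  using assms by (auto simp: vnorm_L2_set L2_set_eq_0_iff intro!: eq_vecI)

lemma vnorm_add_le:
  assumes "v \<in> carrier_vec n" "w \<in> carrier_vec n"
  shows "vnorm (v + w) \<le> vnorm v + vnorm w"
proof -
  have "vnorm (v + w) = L2_set (\<lambda>i. v $ i + w $ i) {0..<n}"
    using assms by (auto simp: vnorm_L2_set intro!: L2_set_cong)
  also have "\<dots> \<le> L2_set (\<lambda>i. v $ i) {0..<n} + L2_set (\<lambda>i. w $ i) {0..<n}"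
    by (rule L2_set_triangle_ineq)
  finally show ?thesis
    using assms by (simp add: vnorm_L2_set)
qed

lemma vnorm_uminus: "vnorm (- v) = vnorm v"
  by (simp add: vnorm_L2_set L2_set_def)

lemma vnorm_minus_le:
  assumes "v \<in> carrier_vec n" "w \<in> carrier_vec n"
  shows "vnorm (v - w) \<le> vnorm v + vnorm w"
proof -
  have "v - w = v + - w"
    using assms by auto
  with vnorm_add_le[of v n "- w"] assms show ?thesis
    by (simp add: vnorm_uminus)
qed

lemma vnorm_minus_commute:
  assumes "v \<in> carrier_vec n" "w \<in> carrier_vec n"
  shows "vnorm (v - w) = vnorm (w - v)"
proof -
  have "v - w = - (w - v)"
    using assms by (intro eq_vecI) auto
  then show ?thesis
    by (simp only: vnorm_uminus)
qed

lemma vnorm_le_add_minus: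
  assumes "v \<in> carrier_vec n" "w \<in> carrier_vec n"
  shows "vnorm v \<le> vnorm w + vnorm (v - w)"
proof -
  have "v = w + (v - w)"
    using assms by auto
  with vnorm_add_le[of w n "v - w"] assms show ?thesis
    by simp
qed

lemma vnorm_smult: "vnorm (c \<cdot>\<^sub>v v) = \<bar>c\<bar> * vnorm v"
  by (simp add: vnorm_def real_sqrt_mult real_sqrt_abs2 flip: mult.assoc)

lemma abs_scalar_prod_le:
  assumes "v \<in> carrier_vec n" "w \<in> carrier_vec n"
  shows "\<bar>v \<bullet> w\<bar> \<le> vnorm v * vnorm w"
proof -
  have "\<bar>v \<bullet> w\<bar> \<le> (\<Sum>i\<in>{0..<n}. \<bar>v $ i\<bar> * \<bar>w $ i\<bar>)"
    using assms sum_abs[of "\<lambda>i. v $ i * w $ i" "{0..<n}"] by (simp add: scalar_prod_def abs_mult)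
  also have "\<dots> \<le> L2_set (\<lambda>i. v $ i) {0..<n} * L2_set (\<lambda>i. w $ i) {0..<n}"
    by (rule L2_set_mult_ineq)
  finally show ?thesis
    using assms by (simp add: vnorm_L2_set)
qed

lemma vnorm_append_power2:
  assumes "v \<in> carrier_vec n" "w \<in> carrier_vec k"
  shows "(vnorm (v @\<^sub>v w))\<^sup>2 = (vnorm v)\<^sup>2 + (vnorm w)\<^sup>2"
  using scalar_prod_append[OF assms assms] by (simp add: vnorm_power2)

text \<open>Cauchy-Schwarz row by row. The constant is crude; it only has to show that the supremum
  defining \<open>norm2\<close> is taken over a bounded set.\<close>

lemma vnorm_mult_mat_vec_bounded:
  fixes A :: "real mat"
  assumes "A \<in> carrier_mat m n" "x \<in> carrier_vec n"
  shows "vnorm (A *\<^sub>v x) \<le> (\<Sum>i\<in>{0..<m}. vnorm (row A i)) * vnorm x"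
proof -
  have "vnorm (A *\<^sub>v x) \<le> (\<Sum>i\<in>{0..<m}. \<bar>(A *\<^sub>v x) $ i\<bar>)"
    using assms L2_set_le_sum_abs[of "\<lambda>i. (A *\<^sub>v x) $ i" "{0..<m}"]
    by (simp add: vnorm_L2_set del: index_mult_mat_vec)
  also have "\<dots> \<le> (\<Sum>i\<in>{0..<m}. vnorm (row A i) * vnorm x)"
  proof (rule sum_mono)
    fix i
    assume "i \<in> {0..<m}"
    then show "\<bar>(A *\<^sub>v x) $ i\<bar> \<le> vnorm (row A i) * vnorm x"
      using assms abs_scalar_prod_le[of "row A i" n x] by auto
  qed
  finally show ?thesis
    by (simp add: sum_distrib_right)
qed

section \<open>The operator norm as a supremum over the unit ball\<close>

lemma norm2_altdef:
  "norm2 A = (SUP x \<in> {x \<in> carrier_vec (dim_col A). vnorm x \<le> 1}. vnorm (A *\<^sub>v x))"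
  by (simp add: norm2_def vnorm_def)

lemma bdd_above_norm2:
  "bdd_above ((\<lambda>x. vnorm (A *\<^sub>v x)) ` {x \<in> carrier_vec (dim_col A). vnorm x \<le> 1})"
proof (rule bdd_aboveI2)
  fix x
  assume "x \<in> {x \<in> carrier_vec (dim_col A). vnorm x \<le> 1}"
  then have x: "x \<in> carrier_vec (dim_col A)" "vnorm x \<le> 1"
    by auto
  let ?K = "\<Sum>i\<in>{0..<dim_row A}. vnorm (row A i)"
  have "vnorm (A *\<^sub>v x) \<le> ?K * vnorm x"
    using x by (intro vnorm_mult_mat_vec_bounded) auto
  also have "\<dots> \<le> ?K"
    using x by (intro mult_left_le sum_nonneg) auto
  finally show "vnorm (A *\<^sub>v x) \<le> ?K" .
qed

lemma norm2_nonneg [simp]: "0 \<le> norm2 A"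
proof -
  have "vnorm (A *\<^sub>v 0\<^sub>v (dim_col A)) \<le> norm2 A"
    unfolding norm2_altdef by (intro cSUP_upper bdd_above_norm2) auto
  then show ?thesis
    using vnorm_nonneg order_trans by blast
qed

lemma vnorm_mult_mat_vec_le:
  assumes A: "A \<in> carrier_mat m n" and x: "x \<in> carrier_vec n"
  shows "vnorm (A *\<^sub>v x) \<le> norm2 A * vnorm x"
proof (cases "vnorm x = 0")
  case True
  then have "A *\<^sub>v x = 0\<^sub>v m"
    using A x by (auto simp: vnorm_eq_0_iff)
  then show ?thesis
    using True by simp
next
  case False
  then have pos: "0 < vnorm x"
    using vnorm_nonneg[of x] by linarith
  let ?y = "(1 / vnorm x) \<cdot>\<^sub>v x"
  have "vnorm (A *\<^sub>v ?y) \<le> norm2 A"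
    unfolding norm2_altdef
    using A x pos by (intro cSUP_upper bdd_above_norm2) (auto simp: vnorm_smult)
  moreover have "A *\<^sub>v ?y = (1 / vnorm x) \<cdot>\<^sub>v (A *\<^sub>v x)"
    using A x by (simp add: mult_mat_vec)
  ultimately show ?thesis
    using pos by (simp add: vnorm_smult field_simps)
qed

lemma vnorm_mult_mat_vec_le_trans:
  assumes "A \<in> carrier_mat m n" "x \<in> carrier_vec n" "norm2 A \<le> c"
  shows "vnorm (A *\<^sub>v x) \<le> c * vnorm x"
  using vnorm_mult_mat_vec_le[OF assms(1,2)] mult_right_mono[OF assms(3) vnorm_nonneg[of x]]
  by linarith

lemma norm2_leI:
  assumes "0 \<le> c" "A \<in> carrier_mat m n"
    and "\<And>x. x \<in> carrier_vec n \<Longrightarrow> vnorm (A *\<^sub>v x) \<le> c * vnorm x"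
  shows "norm2 A \<le> c"
  unfolding norm2_altdef
proof (rule cSUP_least)
  have "0\<^sub>v (dim_col A) \<in> {x \<in> carrier_vec (dim_col A). vnorm x \<le> 1}"
    by simp
  then show "{x \<in> carrier_vec (dim_col A). vnorm x \<le> 1} \<noteq> {}"
    by blast
next
  fix x
  assume "x \<in> {x \<in> carrier_vec (dim_col A). vnorm x \<le> 1}"
  then show "vnorm (A *\<^sub>v x) \<le> c"
    using assms(2) assms(3)[of x] mult_left_le[of "vnorm x" c] assms(1) by force
qed

text \<open>With \<open>z = A\<^sup>T y\<close>, the square of the length of \<open>z\<close> is the
  scalar product of \<open>y\<close> and \<open>A z\<close>, hence at most
  \<open>vnorm y * norm2 A * vnorm z\<close>; one factor \<open>vnorm z\<close> cancels.\<close>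

lemma norm2_transpose_le:
  assumes A: "A \<in> carrier_mat m n"
  shows "norm2 A\<^sup>T \<le> norm2 A"
proof (rule norm2_leI[of _ _ n m])
  fix y :: "real vec"
  assume y: "y \<in> carrier_vec m"
  let ?z = "A\<^sup>T *\<^sub>v y"
  have z: "?z \<in> carrier_vec n"
    using A y by auto
  have "(vnorm ?z)\<^sup>2 = y \<bullet> (A *\<^sub>v ?z)"
    using transpose_vec_mult_scalar[OF A z y] by (simp add: vnorm_power2)
  also have "\<dots> \<le> vnorm y * vnorm (A *\<^sub>v ?z)"
    using abs_scalar_prod_le[of y m "A *\<^sub>v ?z"] A y by auto
  also have "\<dots> \<le> vnorm y * (norm2 A * vnorm ?z)"
    using vnorm_mult_mat_vec_le[OF A z] by (simp add: mult_left_mono)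
  finally have "vnorm ?z * vnorm ?z \<le> (norm2 A * vnorm y) * vnorm ?z"
    by (simp add: power2_eq_square mult_ac)
  then show "vnorm ?z \<le> norm2 A * vnorm y"
    by (cases "vnorm ?z = 0") (auto simp: less_le mult_le_cancel_right)
qed (use A in auto)

lemma norm2_mult_le:
  assumes A: "A \<in> carrier_mat m n" and B: "B \<in> carrier_mat n k"
  shows "norm2 (A * B) \<le> norm2 A * norm2 B"
proof (rule norm2_leI[of _ _ m k])
  fix x :: "real vec"
  assume x: "x \<in> carrier_vec k"
  have "vnorm (A *\<^sub>v (B *\<^sub>v x)) \<le> norm2 A * vnorm (B *\<^sub>v x)"
    using B x by (intro vnorm_mult_mat_vec_le[OF A]) auto
  also have "\<dots> \<le> norm2 A * (norm2 B * vnorm x)"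
    using vnorm_mult_mat_vec_le[OF B x] by (simp add: mult_left_mono)
  finally show "vnorm (A * B *\<^sub>v x) \<le> norm2 A * norm2 B * vnorm x"
    using A B x by (simp add: mult.assoc)
qed (use A B in auto)

lemma norm2_add_le:
  assumes A: "A \<in> carrier_mat m n" and B: "B \<in> carrier_mat m n"
  shows "norm2 (A + B) \<le> norm2 A + norm2 B"
proof (rule norm2_leI[of _ _ m n])
  fix x :: "real vec"
  assume x: "x \<in> carrier_vec n"
  then have "vnorm ((A + B) *\<^sub>v x) \<le> vnorm (A *\<^sub>v x) + vnorm (B *\<^sub>v x)"
    using A B vnorm_add_le[of "A *\<^sub>v x" m "B *\<^sub>v x"] by (simp add: add_mult_distrib_mat_vec)
  then show "vnorm ((A + B) *\<^sub>v x) \<le> (norm2 A + norm2 B) * vnorm x"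
    using vnorm_mult_mat_vec_le[OF A x] vnorm_mult_mat_vec_le[OF B x] by (simp add: algebra_simps)
qed (use A B in auto)

lemma norm2_minus_le:
  assumes A: "A \<in> carrier_mat m n" and B: "B \<in> carrier_mat m n"
  shows "norm2 (A - B) \<le> norm2 A + norm2 B"
proof (rule norm2_leI[of _ _ m n])
  fix x :: "real vec"
  assume x: "x \<in> carrier_vec n"
  then have "vnorm ((A - B) *\<^sub>v x) \<le> vnorm (A *\<^sub>v x) + vnorm (B *\<^sub>v x)"
    using A B vnorm_minus_le[of "A *\<^sub>v x" m "B *\<^sub>v x"] by (simp add: minus_mult_distrib_mat_vec)
  then show "vnorm ((A - B) *\<^sub>v x) \<le> (norm2 A + norm2 B) * vnorm x"
    using vnorm_mult_mat_vec_le[OF A x] vnorm_mult_mat_vec_le[OF B x] by (simp add: algebra_simps)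
qed (use A B in auto)

lemma norm2_pos:
  assumes A: "A \<in> carrier_mat m n" and j: "j < n" and "col A j \<noteq> 0\<^sub>v m"
  shows "0 < norm2 A"
proof (rule ccontr)
  assume "\<not> 0 < norm2 A"
  then have "norm2 A = 0"
    using norm2_nonneg[of A] by linarith
  then have "vnorm (A *\<^sub>v unit_vec n j) = 0"
    using vnorm_mult_mat_vec_le[OF A, of "unit_vec n j"] vnorm_nonneg[of "A *\<^sub>v unit_vec n j"]
    by simp
  moreover have "A *\<^sub>v unit_vec n j = col A j"
    using A j by (auto intro!: eq_vecI)
  ultimately show False
    using assms vnorm_eq_0_iff[of "col A j" m] by simp
qed

text \<open>A maximal independent set of columns has \<open>nc\<close> elements, as many as there
  are columns at all, so it contains every column; an independent set does not contain 0.\<close>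

lemma full_rank_col_nonzero:
  fixes A :: "'a :: field mat"
  assumes A: "A \<in> carrier_mat n nc" and rank: "vec_space.rank n A = nc" and j: "j < nc"
  shows "col A j \<noteq> 0\<^sub>v n"
proof
  interpret vec_space "TYPE('a)" n .
  assume z: "col A j = 0\<^sub>v n"
  have "\<exists>S. finite S \<and> maximal S (\<lambda>T. T \<subseteq> set (cols A) \<and> lin_indpt T) \<and> {} \<subseteq> S"
    by (rule maximal_exists_superset[of "set (cols A)"]) (auto simp: lin_dep_def)
  then obtain S where S: "maximal S (\<lambda>T. T \<subseteq> set (cols A) \<and> lin_indpt T)"
    by blast
  then have sub: "S \<subseteq> set (cols A)" and li: "lin_indpt S"
    by (auto simp: maximal_def)
  have "card S = nc"
    using rank_card_indpt[OF A S] rank by simp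
  moreover have "card (set (cols A)) \<le> nc"
    using card_length[of "cols A"] A by simp
  ultimately have "S = set (cols A)"
    using sub by (metis List.finite_set card_seteq)
  moreover have "col A j \<in> set (cols A)"
    using A j by (metis carrier_matD(2) cols_length cols_nth nth_mem)
  moreover have "S \<subseteq> carrier_vec n"
    using sub cols_dim[of A] A by auto
  moreover have "(UNIV :: 'a set) \<noteq> {0}"
    using one_neq_zero by blast
  ultimately show False
    using zero_nin_lin_indpt[of S] li z by (auto simp: module_vec_def)
qed

text \<open>Serves to substitute \<open>w = A v\<close> in estimates that are known only on vectors
  of the form \<open>A v\<close>.\<close>

lemma inj_square_mat_surj:
  fixes A :: "'a :: field mat"
  assumes A: "A \<in> carrier_mat n n"
    and inj: "\<And>v. v \<in> carrier_vec n \<Longrightarrow> A *\<^sub>v v = 0\<^sub>v n \<Longrightarrow> v = 0\<^sub>v n"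
    and w: "w \<in> carrier_vec n"
  obtains v where "v \<in> carrier_vec n" "A *\<^sub>v v = w"
proof -
  have "det A \<noteq> 0"
    using det_0_iff_vec_prod_zero_field[OF A] inj by blast
  from det_non_zero_imp_unit[OF A this, of "()"]
  obtain B where B: "B \<in> carrier_mat n n" "A * B = 1\<^sub>m n"
    unfolding Units_def by (auto simp: ring_mat_def)
  show ?thesis
  proof
    show "B *\<^sub>v w \<in> carrier_vec n"
      using B w by auto
    show "A *\<^sub>v (B *\<^sub>v w) = w"
      using A B w by (metis assoc_mult_mat_vec one_mult_mat_vec)
  qed
qed

subsection \<open>Near-orthonormal columns\<close>

lemma orth_defect_nonneg [simp]: "0 \<le> orth_defect Q"
  by (simp add: orth_defect_def)

lemma gram_mult_vec:
  fixes Q :: "real mat"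
  assumes Q: "Q \<in> carrier_mat m n" and v: "v \<in> carrier_vec n"
  shows "(1\<^sub>m n - Q\<^sup>T * Q) *\<^sub>v v = v - Q\<^sup>T *\<^sub>v (Q *\<^sub>v v)"
  using Q v by (simp add: minus_mult_distrib_mat_vec[of _ n n])

text \<open>The difference of squares is, up to sign, the quadratic form of
  \<open>I - Q\<^sup>T Q\<close> at \<open>v\<close>; then Cauchy-Schwarz.\<close>

lemma orth_defect_power2:
  assumes Q: "Q \<in> carrier_mat m n" and v: "v \<in> carrier_vec n"
  shows "\<bar>(vnorm (Q *\<^sub>v v))\<^sup>2 - (vnorm v)\<^sup>2\<bar> \<le> orth_defect Q * (vnorm v)\<^sup>2"
proof -
  let ?D = "1\<^sub>m n - Q\<^sup>T * Q"
  have D: "?D \<in> carrier_mat n n"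
    using Q by auto
  have Qv: "Q *\<^sub>v v \<in> carrier_vec m"
    using Q v by auto
  have Tv: "Q\<^sup>T *\<^sub>v (Q *\<^sub>v v) \<in> carrier_vec n"
    using Q v by auto
  have "(vnorm v)\<^sup>2 - (vnorm (Q *\<^sub>v v))\<^sup>2 = v \<bullet> v - (Q\<^sup>T *\<^sub>v (Q *\<^sub>v v)) \<bullet> v"
    using transpose_vec_mult_scalar[OF Q v Qv] by (simp add: vnorm_power2)
  also have "\<dots> = v \<bullet> v - v \<bullet> (Q\<^sup>T *\<^sub>v (Q *\<^sub>v v))"
    using comm_scalar_prod[OF v Tv] by simp
  also have "\<dots> = v \<bullet> (?D *\<^sub>v v)"
    unfolding gram_mult_vec[OF Q v] using scalar_prod_minus_distrib[OF v v Tv] by simp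
  finally have "\<bar>(vnorm (Q *\<^sub>v v))\<^sup>2 - (vnorm v)\<^sup>2\<bar> = \<bar>v \<bullet> (?D *\<^sub>v v)\<bar>"
    by linarith
  also have "\<dots> \<le> vnorm v * vnorm (?D *\<^sub>v v)"
    using D v by (intro abs_scalar_prod_le) auto
  also have "\<dots> \<le> vnorm v * (orth_defect Q * vnorm v)"
    using vnorm_mult_mat_vec_le[OF D v] Q by (simp add: orth_defect_def mult_left_mono)
  finally show ?thesis
    by (simp add: power2_eq_square mult_ac)
qed

lemma norm2_le_orth_defect:
  assumes Q: "Q \<in> carrier_mat m n" and d: "orth_defect Q \<le> d"
  shows "norm2 Q \<le> 1 + d"
proof (rule norm2_leI)
  have d0: "0 \<le> d"
    using d orth_defect_nonneg order_trans by blast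
  then show "0 \<le> 1 + d"
    by simp
  show "Q \<in> carrier_mat m n"
    by fact
  fix v :: "real vec"
  assume v: "v \<in> carrier_vec n"
  have "(vnorm (Q *\<^sub>v v))\<^sup>2 \<le> (vnorm v)\<^sup>2 + d * (vnorm v)\<^sup>2"
    using orth_defect_power2[OF Q v] mult_right_mono[OF d, of "(vnorm v)\<^sup>2"] by simp
  also have "\<dots> = (1 + d) * (vnorm v)\<^sup>2"
    by (simp add: algebra_simps)
  \<comment> \<open>Replacing \<open>sqrt (1 + d)\<close> by \<open>1 + d\<close> costs only
    second-order terms later and keeps the bound polynomial.\<close>
  also have "\<dots> \<le> (1 + d)\<^sup>2 * (vnorm v)\<^sup>2"
    using d0 by (intro mult_right_mono) (auto simp: power2_eq_square algebra_simps)
  finally have "(vnorm (Q *\<^sub>v v))\<^sup>2 \<le> ((1 + d) * vnorm v)\<^sup>2"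
    by (simp add: power_mult_distrib)
  then show "vnorm (Q *\<^sub>v v) \<le> (1 + d) * vnorm v"
    by (rule power2_le_imp_le) (use d0 in simp)
qed

section \<open>Orthogonality defect of two adjoined blocks\<close>

lemma hcat_carrier:
  assumes "U \<in> carrier_mat m t" "Q \<in> carrier_mat m p"
  shows "hcat U Q \<in> carrier_mat m (t + p)"
  using assms by (intro carrier_matI) (auto simp: hcat_def)

text \<open>The lower blocks of \<open>hcat\<close> have no rows, so they add only zero matrices to
  the block product.\<close>

lemma gram_hcat:
  assumes U: "U \<in> carrier_mat m t" and Q: "Q \<in> carrier_mat m p"
  shows "(hcat U Q)\<^sup>T * hcat U Q = four_block_mat (U\<^sup>T * U) (U\<^sup>T * Q) (Q\<^sup>T * U) (Q\<^sup>T * Q)"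
proof -
  have T: "(hcat U Q)\<^sup>T = four_block_mat U\<^sup>T (0\<^sub>m 0 t)\<^sup>T Q\<^sup>T (0\<^sub>m 0 p)\<^sup>T"
    using U Q unfolding hcat_def by (subst transpose_four_block_mat[of _ m t _ p _ 0]) auto
  show ?thesis
    unfolding T using U Q unfolding hcat_def
    by (subst mult_four_block_mat[of _ t m _ 0 _ p _ _ t _ p]) auto
qed

text \<open>The Frobenius bound for the symmetric 2 by 2 matrix with diagonal \<open>a\<close>,
  \<open>c\<close> and off-diagonal entry \<open>b\<close>. By Lagrange's identity in each row, the
  gap is a sum of two squares.\<close>

lemma sq_sum_le:
  fixes a b c x y :: real
  shows "(a * x + b * y)\<^sup>2 + (b * x + c * y)\<^sup>2 \<le> (a\<^sup>2 + 2 * b\<^sup>2 + c\<^sup>2) * (x\<^sup>2 + y\<^sup>2)"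
proof -
  have "(a\<^sup>2 + 2 * b\<^sup>2 + c\<^sup>2) * (x\<^sup>2 + y\<^sup>2) - ((a * x + b * y)\<^sup>2 + (b * x + c * y)\<^sup>2)
    = (a * y - b * x)\<^sup>2 + (b * y - c * x)\<^sup>2"
    by (simp add: power2_eq_square algebra_simps)
  then show ?thesis
    using zero_le_power2[of "a * y - b * x"] zero_le_power2[of "b * y - c * x"] by linarith
qed

text \<open>Taking norms block by block reduces the claim to the 2 by 2 matrix of
  \<open>sq_sum_le\<close>, applied to the lengths of the two parts of a vector.\<close>

lemma orth_defect_hcat_le:
  assumes U: "U \<in> carrier_mat m t" and Q: "Q \<in> carrier_mat m p"
    and a: "orth_defect U \<le> a" and b: "norm2 (U\<^sup>T * Q) \<le> b" and c: "orth_defect Q \<le> c"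
  shows "orth_defect (hcat U Q) \<le> sqrt (a\<^sup>2 + 2 * b\<^sup>2 + c\<^sup>2)"
proof -
  let ?DU = "1\<^sub>m t - U\<^sup>T * U" and ?DQ = "1\<^sub>m p - Q\<^sup>T * Q"
  let ?M = "four_block_mat ?DU (- (U\<^sup>T * Q)) (- (Q\<^sup>T * U)) ?DQ"
  have DU: "?DU \<in> carrier_mat t t" and DQ: "?DQ \<in> carrier_mat p p"
    and UQ: "U\<^sup>T * Q \<in> carrier_mat t p" and QU: "Q\<^sup>T * U \<in> carrier_mat p t"
    using U Q by auto
  \<comment> \<open>The lower left block is the transpose of the upper right one, so
    \<open>b\<close> bounds both.\<close>
  have QU_b: "norm2 (Q\<^sup>T * U) \<le> b"
  proof -
    have "(U\<^sup>T * Q)\<^sup>T = Q\<^sup>T * U"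
      using U Q by (simp add: transpose_mult[of _ t m _ p])
    then show ?thesis
      using norm2_transpose_le[OF UQ] b by simp
  qed
  have M: "1\<^sub>m (t + p) - (hcat U Q)\<^sup>T * hcat U Q = ?M"
    unfolding gram_hcat[OF U Q] using U Q by (intro eq_matI) auto
  have dim: "dim_col (hcat U Q) = t + p"
    using hcat_carrier[OF U Q] by simp
  have nn: "0 \<le> a" "0 \<le> b" "0 \<le> c"
    using a b c orth_defect_nonneg norm2_nonneg order_trans by metis+
  have "norm2 ?M \<le> sqrt (a\<^sup>2 + 2 * b\<^sup>2 + c\<^sup>2)"
  proof (rule norm2_leI)
    show "?M \<in> carrier_mat (t + p) (t + p)"
      using DU DQ by (rule four_block_carrier_mat)
    fix z :: "real vec"
    assume z: "z \<in> carrier_vec (t + p)"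
    define x y where "x = vec_first z t" and "y = vec_last z p"
    have x: "x \<in> carrier_vec t" and y: "y \<in> carrier_vec p" and zxy: "z = x @\<^sub>v y"
      using z by (auto simp: x_def y_def)
    have Mz: "?M *\<^sub>v z = (?DU *\<^sub>v x + (- (U\<^sup>T * Q)) *\<^sub>v y) @\<^sub>v ((- (Q\<^sup>T * U)) *\<^sub>v x + ?DQ *\<^sub>v y)"
      unfolding zxy using DU DQ UQ QU x y by (intro four_block_mat_mult_vec) auto
    have 1: "vnorm (?DU *\<^sub>v x + (- (U\<^sup>T * Q)) *\<^sub>v y) \<le> a * vnorm x + b * vnorm y"
    proof -
      have "vnorm (?DU *\<^sub>v x + (- (U\<^sup>T * Q)) *\<^sub>v y)
          \<le> vnorm (?DU *\<^sub>v x) + vnorm ((U\<^sup>T * Q) *\<^sub>v y)"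
        using U Q DU UQ x y vnorm_add_le[of "?DU *\<^sub>v x" t "(- (U\<^sup>T * Q)) *\<^sub>v y"]
        by (simp add: uminus_mult_mat_vec vnorm_uminus)
      moreover have "vnorm (?DU *\<^sub>v x) \<le> a * vnorm x"
        using a U by (intro vnorm_mult_mat_vec_le_trans[OF DU x]) (simp add: orth_defect_def)
      moreover have "vnorm ((U\<^sup>T * Q) *\<^sub>v y) \<le> b * vnorm y"
        by (rule vnorm_mult_mat_vec_le_trans[OF UQ y b])
      ultimately show ?thesis
        by linarith
    qed
    have 2: "vnorm ((- (Q\<^sup>T * U)) *\<^sub>v x + ?DQ *\<^sub>v y) \<le> b * vnorm x + c * vnorm y"
    proof -
      have "vnorm ((- (Q\<^sup>T * U)) *\<^sub>v x + ?DQ *\<^sub>v y)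
          \<le> vnorm ((Q\<^sup>T * U) *\<^sub>v x) + vnorm (?DQ *\<^sub>v y)"
        using U Q DQ QU x y vnorm_add_le[of "(- (Q\<^sup>T * U)) *\<^sub>v x" p "?DQ *\<^sub>v y"]
        by (simp add: uminus_mult_mat_vec vnorm_uminus)
      moreover have "vnorm (?DQ *\<^sub>v y) \<le> c * vnorm y"
        using c Q by (intro vnorm_mult_mat_vec_le_trans[OF DQ y]) (simp add: orth_defect_def)
      moreover have "vnorm ((Q\<^sup>T * U) *\<^sub>v x) \<le> b * vnorm x"
        by (rule vnorm_mult_mat_vec_le_trans[OF QU x QU_b])
      ultimately show ?thesis
        by linarith
    qed
    have "(vnorm (?M *\<^sub>v z))\<^sup>2 = (vnorm (?DU *\<^sub>v x + (- (U\<^sup>T * Q)) *\<^sub>v y))\<^sup>2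
        + (vnorm ((- (Q\<^sup>T * U)) *\<^sub>v x + ?DQ *\<^sub>v y))\<^sup>2"
      unfolding Mz using DU DQ UQ QU x y by (intro vnorm_append_power2[of _ t _ p]) auto
    also have "\<dots> \<le> (a * vnorm x + b * vnorm y)\<^sup>2 + (b * vnorm x + c * vnorm y)\<^sup>2"
      using 1 2 by (intro add_mono power_mono) auto
    also have "\<dots> \<le> (a\<^sup>2 + 2 * b\<^sup>2 + c\<^sup>2) * ((vnorm x)\<^sup>2 + (vnorm y)\<^sup>2)"
      by (rule sq_sum_le)
    also have "\<dots> = (sqrt (a\<^sup>2 + 2 * b\<^sup>2 + c\<^sup>2) * vnorm z)\<^sup>2"
      unfolding zxy using vnorm_append_power2[OF x y] by (simp add: power_mult_distrib)
    finally show "vnorm (?M *\<^sub>v z) \<le> sqrt (a\<^sup>2 + 2 * b\<^sup>2 + c\<^sup>2) * vnorm z"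
      by (rule power2_le_imp_le) simp
  qed simp
  then show ?thesis
    by (simp add: orth_defect_def dim M)
qed

subsection \<open>One step of block Gram-Schmidt\<close>

text \<open>The total rounding error of one pass, measured against the exact residual
  \<open>B - U U\<^sup>T B\<close> for the given \<open>U\<close>, which need not be exactly
  orthonormal.\<close>

definition cgs_error :: "real mat \<Rightarrow> real mat \<Rightarrow> real mat \<Rightarrow> real mat \<Rightarrow> real mat" where
  "cgs_error U B Q R = Q * R - (B - U * (U\<^sup>T * B))"

lemma cgs_error_carrier:
  assumes "U \<in> carrier_mat m t" "B \<in> carrier_mat m p" "Q \<in> carrier_mat m p" "R \<in> carrier_mat p p"
  shows "cgs_error U B Q R \<in> carrier_mat m p"
  using assms by (intro carrier_matI) (simp_all add: cgs_error_def)

lemma cgs_error_split: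
  fixes QR B P S Y :: "real mat"
  assumes "QR \<in> carrier_mat m p" "B \<in> carrier_mat m p" "P \<in> carrier_mat m p"
    "S \<in> carrier_mat m p" "Y \<in> carrier_mat m p"
  shows "QR - (B - P) = (P - S) - (B - S - Y) + (QR - Y)"
  using assms by (intro eq_matI) auto

text \<open>The three backward errors telescope; the one in \<open>S\<close> reaches the residual
  only after multiplication by \<open>U\<close>.\<close>

lemma norm2_cgs_error_le:
  assumes U: "U \<in> carrier_mat m t" and B: "B \<in> carrier_mat m p" and Q: "Q \<in> carrier_mat m p"
    and R: "R \<in> carrier_mat p p" and S: "S \<in> carrier_mat t p" and Y: "Y \<in> carrier_mat m p"
  shows "norm2 (cgs_error U B Q R)
    \<le> norm2 U * norm2 (U\<^sup>T * B - S) + norm2 (B - U * S - Y) + norm2 (Q * R - Y)"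
proof -
  have UB: "U\<^sup>T * B \<in> carrier_mat t p"
    using U B by auto
  have UUB: "U * (U\<^sup>T * B) \<in> carrier_mat m p"
    using U UB by (rule mult_carrier_mat)
  have US: "U * S \<in> carrier_mat m p" and QR: "Q * R \<in> carrier_mat m p"
    using U S Q R by auto
  have D: "U\<^sup>T * B - S \<in> carrier_mat t p"
    using S by auto
  have "cgs_error U B Q R = U * (U\<^sup>T * B - S) - (B - U * S - Y) + (Q * R - Y)"
    unfolding cgs_error_def mult_minus_distrib_mat[OF U UB S]
    by (rule cgs_error_split[OF QR B UUB US Y])
  also have "norm2 \<dots> \<le> norm2 (U * (U\<^sup>T * B - S) - (B - U * S - Y)) + norm2 (Q * R - Y)"
    using Y by (intro norm2_add_le[of _ m p]) auto
  also have "norm2 (U * (U\<^sup>T * B - S) - (B - U * S - Y))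
      \<le> norm2 (U * (U\<^sup>T * B - S)) + norm2 (B - U * S - Y)"
    using Y U D by (intro norm2_minus_le[of _ m p]) auto
  also have "norm2 (U * (U\<^sup>T * B - S)) \<le> norm2 U * norm2 (U\<^sup>T * B - S)"
    by (rule norm2_mult_le[OF U D])
  finally show ?thesis
    by simp
qed

lemma cgs_error_mult_vec:
  assumes U: "U \<in> carrier_mat m t" and B: "B \<in> carrier_mat m p" and Q: "Q \<in> carrier_mat m p"
    and R: "R \<in> carrier_mat p p" and v: "v \<in> carrier_vec p"
  shows "cgs_error U B Q R *\<^sub>v v
    = Q *\<^sub>v (R *\<^sub>v v) - (B *\<^sub>v v - U *\<^sub>v (U\<^sup>T *\<^sub>v (B *\<^sub>v v)))"
proof -
  have UUB: "U * (U\<^sup>T * B) \<in> carrier_mat m p"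
    using U B by auto
  have "cgs_error U B Q R *\<^sub>v v = (Q * R) *\<^sub>v v - (B *\<^sub>v v - (U * (U\<^sup>T * B)) *\<^sub>v v)"
  proof -
    have QR: "Q * R \<in> carrier_mat m p" and BP: "B - U * (U\<^sup>T * B) \<in> carrier_mat m p"
      using Q R minus_carrier_mat[OF UUB] by auto
    show ?thesis
      unfolding cgs_error_def minus_mult_distrib_mat_vec[OF QR BP v]
        minus_mult_distrib_mat_vec[OF B UUB v] ..
  qed
  moreover have "(U * (U\<^sup>T * B)) *\<^sub>v v = U *\<^sub>v ((U\<^sup>T * B) *\<^sub>v v)"
    using U B v by (intro assoc_mult_mat_vec[of _ m t _ p]) auto
  moreover have "(U\<^sup>T * B) *\<^sub>v v = U\<^sup>T *\<^sub>v (B *\<^sub>v v)"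
    using U B v by (intro assoc_mult_mat_vec[of _ t m _ p]) auto
  moreover have "(Q * R) *\<^sub>v v = Q *\<^sub>v (R *\<^sub>v v)"
    using Q R v by (intro assoc_mult_mat_vec[of _ m p _ p]) auto
  ultimately show ?thesis
    by simp
qed

text \<open>Since \<open>U\<^sup>T (I - U U\<^sup>T) = (I - U\<^sup>T U) U\<^sup>T\<close>, a pass
  damps the component along \<open>U\<close> by the factor \<open>h\<close>, up to rounding. The
  estimate serves both passes.\<close>

lemma cgs_transpose_mult_le:
  assumes U: "U \<in> carrier_mat m t" and B: "B \<in> carrier_mat m p" and Q: "Q \<in> carrier_mat m p"
    and R: "R \<in> carrier_mat p p" and v: "v \<in> carrier_vec p"
    and h: "orth_defect U \<le> h" and e: "norm2 (cgs_error U B Q R) \<le> e"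
  shows "vnorm (U\<^sup>T *\<^sub>v (Q *\<^sub>v (R *\<^sub>v v)))
    \<le> h * vnorm (U\<^sup>T *\<^sub>v (B *\<^sub>v v)) + (1 + h) * e * vnorm v"
proof -
  let ?E = "cgs_error U B Q R" and ?q = "Q *\<^sub>v (R *\<^sub>v v)" and ?b = "B *\<^sub>v v"
  let ?u = "U\<^sup>T *\<^sub>v ?b"
  have UT: "U\<^sup>T \<in> carrier_mat t m"
    using U by simp
  have c: "?q \<in> carrier_vec m" "?b \<in> carrier_vec m" "?u \<in> carrier_vec t"
    "U *\<^sub>v ?u \<in> carrier_vec m" "U\<^sup>T *\<^sub>v (U *\<^sub>v ?u) \<in> carrier_vec t" "U\<^sup>T *\<^sub>v ?q \<in> carrier_vec t"
    using U B Q R v by auto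
  have E: "?E \<in> carrier_mat m p"
    by (rule cgs_error_carrier[OF U B Q R])
  then have Ev: "?E *\<^sub>v v \<in> carrier_vec m"
    using v by auto
  have DU: "1\<^sub>m t - U\<^sup>T * U \<in> carrier_mat t t"
    using U by auto
  have "U\<^sup>T *\<^sub>v (?E *\<^sub>v v) = U\<^sup>T *\<^sub>v ?q - (?u - U\<^sup>T *\<^sub>v (U *\<^sub>v ?u))"
    unfolding cgs_error_mult_vec[OF U B Q R v] using UT c
    by (simp add: mult_minus_distrib_mat_vec[of _ t m])
  also have "\<dots> = U\<^sup>T *\<^sub>v ?q - (1\<^sub>m t - U\<^sup>T * U) *\<^sub>v ?u"
    by (simp add: gram_mult_vec[OF U c(3)])
  finally have eq: "U\<^sup>T *\<^sub>v ?q - (1\<^sub>m t - U\<^sup>T * U) *\<^sub>v ?u = U\<^sup>T *\<^sub>v (?E *\<^sub>v v)" ..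
  have "vnorm (U\<^sup>T *\<^sub>v ?q) \<le> vnorm ((1\<^sub>m t - U\<^sup>T * U) *\<^sub>v ?u) + vnorm (U\<^sup>T *\<^sub>v (?E *\<^sub>v v))"
    unfolding eq[symmetric] using c DU by (intro vnorm_le_add_minus[of _ t]) auto
  also have "vnorm ((1\<^sub>m t - U\<^sup>T * U) *\<^sub>v ?u) \<le> h * vnorm ?u"
    using h U by (intro vnorm_mult_mat_vec_le_trans[OF DU c(3)]) (simp add: orth_defect_def)
  also have "vnorm (U\<^sup>T *\<^sub>v (?E *\<^sub>v v)) \<le> (1 + h) * vnorm (?E *\<^sub>v v)"
    using norm2_transpose_le[OF U] norm2_le_orth_defect[OF U h]
    by (intro vnorm_mult_mat_vec_le_trans[OF UT Ev]) linarith
  also have "\<dots> \<le> (1 + h) * (e * vnorm v)"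
    using orth_defect_nonneg[of U] h
    by (intro mult_left_mono vnorm_mult_mat_vec_le_trans[OF E v e]) linarith
  finally show ?thesis
    by (simp add: mult.assoc)
qed

text \<open>Meant for the lengths \<open>V\<close> of \<open>v\<close>, \<open>W\<close> of
  \<open>R v\<close>, \<open>Z\<close> of \<open>B v\<close>, \<open>u\<close> of
  \<open>U\<^sup>T B v\<close>, \<open>uu\<close> of \<open>U U\<^sup>T B v\<close>,
  \<open>y\<close> of the exact residual and \<open>q\<close> of \<open>Q R v\<close>. First every
  length is bounded by a multiple of \<open>V\<close>, then the errors in the squares are
  added.\<close>

lemma pythagoras_perturbed:
  fixes V W Z u uu y q \<eta> :: real
  assumes nn: "0 \<le> V" "0 \<le> Z" "0 \<le> u" "0 \<le> y" "0 \<le> q" and \<eta>: "0 \<le> \<eta>" "\<eta> \<le> 1 / 2"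
    and q: "\<bar>q\<^sup>2 - W\<^sup>2\<bar> \<le> \<eta> * W\<^sup>2" and Z: "\<bar>Z\<^sup>2 - V\<^sup>2\<bar> \<le> \<eta> * V\<^sup>2"
    and uu: "\<bar>uu\<^sup>2 - u\<^sup>2\<bar> \<le> \<eta> * u\<^sup>2" and y: "y\<^sup>2 = Z\<^sup>2 - 2 * u\<^sup>2 + uu\<^sup>2"
    and qy: "\<bar>q - y\<bar> \<le> \<eta> * V" and u: "u \<le> (1 + \<eta>) * Z"
  shows "\<bar>W\<^sup>2 + u\<^sup>2 - V\<^sup>2\<bar> \<le> 17 * \<eta> * V\<^sup>2"
proof -
  have half: "\<eta> * r \<le> r / 2" if "0 \<le> r" for r
    using mult_right_mono[OF \<eta>(2) that] by simp
  have Z2: "Z\<^sup>2 \<le> 3 / 2 * V\<^sup>2"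
    using Z half[of "V\<^sup>2"] by (simp add: abs_le_iff)
  have "u \<le> 3 / 2 * Z"
    using u half[OF nn(2)] by (simp add: algebra_simps)
  then have "u\<^sup>2 \<le> (3 / 2 * Z)\<^sup>2"
    using nn by (intro power_mono)
  then have "u\<^sup>2 \<le> 9 / 4 * Z\<^sup>2"
    by (simp add: power_mult_distrib power_divide)
  then have u2: "u\<^sup>2 \<le> 4 * V\<^sup>2"
    using Z2 zero_le_power2[of V] by linarith
  have "y\<^sup>2 \<le> Z\<^sup>2"
    using y uu half[of "u\<^sup>2"] zero_le_power2[of u] by (simp add: abs_le_iff)
  also have "\<dots> \<le> 9 / 4 * V\<^sup>2"
    using Z2 zero_le_power2[of V] by linarith
  also have "\<dots> = (3 / 2 * V)\<^sup>2"
    by (simp add: power_mult_distrib power_divide)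
  finally have yV: "y \<le> 3 / 2 * V"
    by (rule power2_le_imp_le) (use nn in simp)
  have qV: "q \<le> 2 * V"
    using qy half[OF nn(1)] yV by (simp add: abs_le_iff)
  have "W\<^sup>2 \<le> 2 * q\<^sup>2"
    using q half[of "W\<^sup>2"] by (simp add: abs_le_iff)
  also have "\<dots> \<le> 2 * (2 * V)\<^sup>2"
    using power_mono[OF qV nn(5), of 2] by simp
  finally have W2: "W\<^sup>2 \<le> 8 * V\<^sup>2"
    by (simp add: power_mult_distrib)
  have "\<bar>q\<^sup>2 - y\<^sup>2\<bar> = \<bar>q - y\<bar> * (q + y)"
    using nn by (simp add: power2_eq_square square_diff_square_factored abs_mult mult.commute)
  also have "\<dots> \<le> (\<eta> * V) * (4 * V)"
    using qy qV yV nn \<eta> by (intro mult_mono) auto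
  finally have "\<bar>q\<^sup>2 - y\<^sup>2\<bar> \<le> 4 * (\<eta> * V\<^sup>2)"
    by (simp add: power2_eq_square mult_ac)
  moreover have "\<bar>q\<^sup>2 - W\<^sup>2\<bar> \<le> 8 * (\<eta> * V\<^sup>2)"
    using q mult_left_mono[OF W2 \<eta>(1)] by simp
  moreover have "\<bar>y\<^sup>2 + u\<^sup>2 - Z\<^sup>2\<bar> \<le> 4 * (\<eta> * V\<^sup>2)"
    using uu y mult_left_mono[OF u2 \<eta>(1)] by simp
  \<comment> \<open>The constant is 17 = 8 + 4 + 4 + 1, for passing from \<open>W\<close> to
    \<open>q\<close>, \<open>q\<close> to \<open>y\<close>, \<open>y\<close> to \<open>Z\<close> and
    \<open>Z\<close> to \<open>V\<close>.\<close>
  ultimately have "\<bar>W\<^sup>2 + u\<^sup>2 - V\<^sup>2\<bar> \<le> 17 * (\<eta> * V\<^sup>2)"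
    using Z unfolding abs_le_iff by linarith
  then show ?thesis
    by (simp add: mult.assoc)
qed

lemma vnorm_minus_power2:
  assumes v: "v \<in> carrier_vec n" and w: "w \<in> carrier_vec n"
  shows "(vnorm (v - w))\<^sup>2 = (vnorm v)\<^sup>2 - 2 * (v \<bullet> w) + (vnorm w)\<^sup>2"
proof -
  have "(v - w) \<bullet> (v - w) = v \<bullet> v - v \<bullet> w - (w \<bullet> v - w \<bullet> w)"
    using v w by (simp add: minus_scalar_prod_distrib[of _ n] scalar_prod_minus_distrib[of _ n])
  then show ?thesis
    using comm_scalar_prod[OF v w] by (simp add: vnorm_power2)
qed

text \<open>With exact orthonormality and no rounding, \<open>B v\<close> has the length of
  \<open>v\<close> and splits orthogonally into a part along \<open>U\<close> and a residual as long
  as \<open>R v\<close>. The assumption that \<open>B\<close> is nearly orthonormal fits the second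
  pass, where \<open>B\<close> is \<open>Q1\<close>.\<close>

lemma cgs_pythagoras:
  assumes U: "U \<in> carrier_mat m t" and B: "B \<in> carrier_mat m p" and Q: "Q \<in> carrier_mat m p"
    and R: "R \<in> carrier_mat p p" and v: "v \<in> carrier_vec p"
    and d: "orth_defect U \<le> \<eta>" "orth_defect B \<le> \<eta>" "orth_defect Q \<le> \<eta>"
    and e: "norm2 (cgs_error U B Q R) \<le> \<eta>" and \<eta>: "\<eta> \<le> 1 / 2"
  shows "\<bar>(vnorm (R *\<^sub>v v))\<^sup>2 + (vnorm (U\<^sup>T *\<^sub>v (B *\<^sub>v v)))\<^sup>2 - (vnorm v)\<^sup>2\<bar> \<le> 17 * \<eta> * (vnorm v)\<^sup>2"
proof -
  let ?E = "cgs_error U B Q R" and ?q = "Q *\<^sub>v (R *\<^sub>v v)" and ?b = "B *\<^sub>v v"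
  let ?u = "U\<^sup>T *\<^sub>v ?b"
  let ?y = "?b - U *\<^sub>v ?u"
  have UT: "U\<^sup>T \<in> carrier_mat t m"
    using U by simp
  have Rv: "R *\<^sub>v v \<in> carrier_vec p"
    using R v by auto
  have c: "?q \<in> carrier_vec m" "?b \<in> carrier_vec m" "?u \<in> carrier_vec t"
    "U *\<^sub>v ?u \<in> carrier_vec m" "?y \<in> carrier_vec m"
    using U B Q R v by auto
  have E: "?E \<in> carrier_mat m p"
    by (rule cgs_error_carrier[OF U B Q R])
  have Ev: "?E *\<^sub>v v = ?q - ?y"
    by (rule cgs_error_mult_vec[OF U B Q R v])
  have Ev': "vnorm (?q - ?y) \<le> \<eta> * vnorm v"
    using vnorm_mult_mat_vec_le_trans[OF E v e] by (simp add: Ev)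
  then have Ev'': "vnorm (?y - ?q) \<le> \<eta> * vnorm v"
    using vnorm_minus_commute[OF c(1,5)] by simp
  have \<eta>0: "0 \<le> \<eta>"
    using d(1) orth_defect_nonneg[of U] by linarith
  have defect: "\<bar>(vnorm (M *\<^sub>v x))\<^sup>2 - (vnorm x)\<^sup>2\<bar> \<le> \<eta> * (vnorm x)\<^sup>2"
    if "M \<in> carrier_mat m k" "x \<in> carrier_vec k" "orth_defect M \<le> \<eta>" for M x k
    using orth_defect_power2[OF that(1,2)] mult_right_mono[OF that(3), of "(vnorm x)\<^sup>2"] by simp
  show ?thesis
  proof (rule pythagoras_perturbed[where Z = "vnorm ?b" and uu = "vnorm (U *\<^sub>v ?u)" and y = "vnorm ?y"
        and q = "vnorm ?q"])
    show "\<bar>(vnorm ?q)\<^sup>2 - (vnorm (R *\<^sub>v v))\<^sup>2\<bar> \<le> \<eta> * (vnorm (R *\<^sub>v v))\<^sup>2"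
      by (rule defect[OF Q Rv d(3)])
    show "\<bar>(vnorm ?b)\<^sup>2 - (vnorm v)\<^sup>2\<bar> \<le> \<eta> * (vnorm v)\<^sup>2"
      by (rule defect[OF B v d(2)])
    show "\<bar>(vnorm (U *\<^sub>v ?u))\<^sup>2 - (vnorm ?u)\<^sup>2\<bar> \<le> \<eta> * (vnorm ?u)\<^sup>2"
      by (rule defect[OF U c(3) d(1)])
    \<comment> \<open>The mixed term is exact even for inexact \<open>U\<close>; only the square of
      \<open>U U\<^sup>T B v\<close> needs the defect of \<open>U\<close>.\<close>
    have "?b \<bullet> (U *\<^sub>v ?u) = (vnorm ?u)\<^sup>2"
      using transpose_vec_mult_scalar[OF U c(3) c(2)] by (simp add: vnorm_power2)
    then show "(vnorm ?y)\<^sup>2 = (vnorm ?b)\<^sup>2 - 2 * (vnorm ?u)\<^sup>2 + (vnorm (U *\<^sub>v ?u))\<^sup>2"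
      using vnorm_minus_power2[OF c(2,4)] by simp
    show "\<bar>vnorm ?q - vnorm ?y\<bar> \<le> \<eta> * vnorm v"
      using vnorm_le_add_minus[OF c(1,5)] vnorm_le_add_minus[OF c(5,1)] Ev' Ev'' by linarith
    show "vnorm ?u \<le> (1 + \<eta>) * vnorm ?b"
      using norm2_transpose_le[OF U] norm2_le_orth_defect[OF U d(1)]
      by (intro vnorm_mult_mat_vec_le_trans[OF UT c(2)]) linarith
  qed (use \<eta> \<eta>0 in auto)
qed

text \<open>Injectivity of \<open>R1\<close> comes out of the estimate itself, so every \<open>v\<close> has the form \<open>R1 u\<close>.\<close>

lemma mult_le_of_perturbed_inverse:
  fixes R R1 R2 W X :: "real mat"
  assumes R: "R \<in> carrier_mat p p" and R1: "R1 \<in> carrier_mat p p" and R2: "R2 \<in> carrier_mat p p"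
    and W: "W \<in> carrier_mat t p" and X: "X \<in> carrier_mat p p" and XR: "X * R = 1\<^sub>m p"
    and c: "0 < c" and f: "0 < f" and l: "0 \<le> l" and \<gamma>: "0 < \<gamma>"
    and W1: "\<And>u. u \<in> carrier_vec p \<Longrightarrow> vnorm (W *\<^sub>v (R1 *\<^sub>v u)) \<le> c * f * vnorm u"
    and RR: "norm2 (R2 * R1 - R) \<le> c * l"
    and cond: "c * norm2 X * (f + \<gamma> * l) \<le> \<gamma>"
    and v: "v \<in> carrier_vec p"
  shows "vnorm (W *\<^sub>v v) \<le> \<gamma> * vnorm (R2 *\<^sub>v v)"
proof -
  have main: "c * f * vnorm u \<le> \<gamma> * vnorm (R2 *\<^sub>v (R1 *\<^sub>v u))" if u: "u \<in> carrier_vec p" for u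
  proof -
    let ?x = "norm2 X" and ?w = "R2 *\<^sub>v (R1 *\<^sub>v u)"
    have D: "R2 * R1 - R \<in> carrier_mat p p"
      using R by auto
    have Du: "(R2 * R1 - R) *\<^sub>v u = ?w - R *\<^sub>v u"
      using R R1 R2 u by (simp add: minus_mult_distrib_mat_vec[of _ p p])
    have cw: "?w \<in> carrier_vec p" and cR: "R *\<^sub>v u \<in> carrier_vec p"
      using R R1 R2 u by auto
    have "vnorm (R *\<^sub>v u - ?w) \<le> c * l * vnorm u"
      using vnorm_mult_mat_vec_le_trans[OF D u RR] vnorm_minus_commute[OF cw cR] unfolding Du by simp
    then have Ru: "vnorm (R *\<^sub>v u) \<le> vnorm ?w + c * l * vnorm u"
      using vnorm_le_add_minus[OF cR cw] by linarith
    have "u = X *\<^sub>v (R *\<^sub>v u)"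
      using R X XR u by (metis assoc_mult_mat_vec one_mult_mat_vec)
    then have "vnorm u \<le> ?x * vnorm (R *\<^sub>v u)"
      using vnorm_mult_mat_vec_le[OF X cR] by simp
    also have "\<dots> \<le> ?x * (vnorm ?w + c * l * vnorm u)"
      using Ru by (intro mult_left_mono) auto
    finally have *: "\<gamma> * vnorm u \<le> \<gamma> * (?x * (vnorm ?w + c * l * vnorm u))"
      using \<gamma> by simp
    have "c * ?x * (f + \<gamma> * l) * vnorm u \<le> \<gamma> * vnorm u"
      using cond by (rule mult_right_mono) simp
    \<comment> \<open>Both sides contain the term
      \<open>\<gamma> * norm2 X * c * l * vnorm u\<close>; it cancels, which is why the condition
      has \<open>\<gamma> * l\<close> next to \<open>f\<close>.\<close>
    with * have **: "?x * (c * f * vnorm u) \<le> ?x * (\<gamma> * vnorm ?w)"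
      by (simp add: algebra_simps)
    show ?thesis
    proof (cases "?x = 0")
      \<comment> \<open>If \<open>X\<close> has norm 0, the factor \<open>norm2 X\<close> cannot be
        cancelled, but then \<open>u = X (R u)\<close> has length 0.\<close>
      case True
      then have "vnorm u = 0"
        using * \<gamma> vnorm_nonneg[of u] by (simp add: mult_le_0_iff)
      then show ?thesis
        using \<gamma> by simp
    next
      case False
      then show ?thesis
        using ** norm2_nonneg[of X] by (simp add: mult_le_cancel_left less_le)
    qed
  qed
  have inj: "u = 0\<^sub>v p" if "u \<in> carrier_vec p" "R1 *\<^sub>v u = 0\<^sub>v p" for u
  proof -
    have "R2 *\<^sub>v (R1 *\<^sub>v u) = 0\<^sub>v p"
      using that R2 by (auto simp: scalar_prod_def intro!: eq_vecI)
    then have "c * f * vnorm u \<le> 0"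
      using main[OF that(1)] by simp
    then have "vnorm u = 0"
      using c f vnorm_nonneg[of u] by (simp add: mult_le_0_iff)
    then show ?thesis
      using vnorm_eq_0_iff[OF that(1)] by simp
  qed
  obtain u where u: "u \<in> carrier_vec p" "R1 *\<^sub>v u = v"
    using inj_square_mat_surj[OF R1 inj v] by blast
  show ?thesis
    using W1[OF u(1)] main[OF u(1)] u(2) by simp
qed

text \<open>\<open>V\<close> makes \<open>R\<close> injective, so every \<open>w\<close> is some
  \<open>R v\<close>; \<open>W\<close> and \<open>V\<close> then turn the damping estimate of
  \<open>cgs_transpose_mult_le\<close> into a bound in terms of \<open>w\<close>.\<close>

lemma norm2_transpose_mult_le:
  assumes U: "U \<in> carrier_mat m t" and Q1: "Q1 \<in> carrier_mat m p" and Q: "Q \<in> carrier_mat m p"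
    and R: "R \<in> carrier_mat p p"
    and h: "orth_defect U \<le> h" and e: "norm2 (cgs_error U Q1 Q R) \<le> e"
    and W: "\<And>v. v \<in> carrier_vec p \<Longrightarrow> vnorm (U\<^sup>T *\<^sub>v (Q1 *\<^sub>v v)) \<le> c * vnorm (R *\<^sub>v v)"
    and V: "\<And>v. v \<in> carrier_vec p \<Longrightarrow> vnorm v \<le> k * vnorm (R *\<^sub>v v)"
    and c: "0 \<le> c" and k: "0 \<le> k"
  shows "norm2 (U\<^sup>T * Q) \<le> h * c + (1 + h) * e * k"
proof (rule norm2_leI)
  have h0: "0 \<le> h"
    using h orth_defect_nonneg[of U] by linarith
  have e0: "0 \<le> e"
    using e norm2_nonneg[of "cgs_error U Q1 Q R"] by linarith
  show "0 \<le> h * c + (1 + h) * e * k"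
    using h0 e0 c k by simp
  show "U\<^sup>T * Q \<in> carrier_mat t p"
    using U Q by auto
  fix w :: "real vec"
  assume w: "w \<in> carrier_vec p"
  have inj: "v = 0\<^sub>v p" if "v \<in> carrier_vec p" "R *\<^sub>v v = 0\<^sub>v p" for v
  proof -
    have "vnorm v = 0"
      using V[OF that(1)] that(2) vnorm_nonneg[of v] by simp
    then show ?thesis
      using vnorm_eq_0_iff[OF that(1)] by simp
  qed
  obtain v where v: "v \<in> carrier_vec p" "R *\<^sub>v v = w"
    using inj_square_mat_surj[OF R inj w] by blast
  have "U\<^sup>T * Q *\<^sub>v w = U\<^sup>T *\<^sub>v (Q *\<^sub>v (R *\<^sub>v v))"
    using U Q w v by (simp add: assoc_mult_mat_vec[of _ t m _ p])
  then have "vnorm (U\<^sup>T * Q *\<^sub>v w) \<le> h * vnorm (U\<^sup>T *\<^sub>v (Q1 *\<^sub>v v)) + (1 + h) * e * vnorm v"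
    using cgs_transpose_mult_le[OF U Q1 Q R v(1) h e] by simp
  also have "\<dots> \<le> h * (c * vnorm w) + (1 + h) * e * (k * vnorm w)"
    using W[OF v(1)] V[OF v(1)] v(2) h0 e0 by (intro add_mono mult_left_mono) auto
  finally show "vnorm (U\<^sup>T * Q *\<^sub>v w) \<le> (h * c + (1 + h) * e * k) * vnorm w"
    by (simp add: algebra_simps)
qed

subsection \<open>The constants\<close>

lemma bcgs_alpha_power2: "bcgs_alpha\<^sup>2 = 7 + 4 * sqrt 2"
  by (simp add: bcgs_alpha_def)

lemma bcgs_gamma_radicand_pos: "0 < (7 + 4 * sqrt 2) * real j + 1"
  by (intro add_nonneg_pos mult_nonneg_nonneg) auto

text \<open>Indexing by \<open>Suc j\<close> turns \<open>k - 1\<close> into the natural number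
  \<open>j\<close>.\<close>

lemma bcgs_gamma_eq:
  "bcgs_gamma (Suc j) = 1 / sqrt ((7 + 4 * sqrt 2) * real j + 1)"
  using bcgs_gamma_radicand_pos[of j]
  by (simp add: bcgs_gamma_def bcgs_alpha_power2 powr_minus powr_half_sqrt inverse_eq_divide)

lemma bcgs_gamma_pos: "0 < bcgs_gamma (Suc j)"
  using bcgs_gamma_radicand_pos[of j] by (simp add: bcgs_gamma_eq)

lemma bcgs_gamma_1 [simp]: "bcgs_gamma (Suc 0) = 1"
  by (simp add: bcgs_gamma_eq)

lemma inverse_bcgs_gamma_power2:
  "(inverse (bcgs_gamma (Suc j)))\<^sup>2 = (7 + 4 * sqrt 2) * real j + 1"
  using bcgs_gamma_radicand_pos[of j] by (simp add: bcgs_gamma_eq)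

lemma bcgs_gamma_Suc_less: "bcgs_gamma (Suc (Suc j)) < bcgs_gamma (Suc j)"
proof -
  have "(7 + 4 * sqrt 2) * real j + 1 < (7 + 4 * sqrt 2) * real (Suc j) + 1"
    by (simp add: algebra_simps add_pos_nonneg)
  then show ?thesis
    unfolding bcgs_gamma_eq using bcgs_gamma_radicand_pos[of j]
    by (intro divide_strict_left_mono) auto
qed

text \<open>For \<open>k \<ge> 2\<close> the radicand is at least 11 + 1. The bound 1/12 is what
  makes 11/10 an admissible constant in the step estimates.\<close>

lemma bcgs_gamma_power2_le: "(bcgs_gamma (Suc (Suc j)))\<^sup>2 \<le> 1 / 12"
proof -
  define x where "x = (7 + 4 * sqrt 2) * real (Suc j)"
  have "1 \<le> sqrt 2"
    by simp
  then have "11 * 1 \<le> x"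
    unfolding x_def by (intro mult_mono) auto
  then have "1 / (x + 1) \<le> 1 / 12"
    by (intro divide_left_mono) auto
  then show ?thesis
    using \<open>11 * 1 \<le> x\<close> by (simp only: bcgs_gamma_eq flip: x_def) (simp add: power_divide)
qed

section \<open>The growth functions and the bounds built from them\<close>

lemma growth_functions_nonneg:
  assumes growth: "growth_functions L1 L2 L3 L4 L5" and m: "1 \<le> m" and p: "1 \<le> p"
  shows "0 < L1 m p" "0 < L5 p" "0 \<le> L2 m t p" "0 \<le> L3 t p"
proof -
  note pos = growth[unfolded growth_functions_def, THEN conjunct1, rule_format, OF m p]
  show "0 < L1 m p" "0 < L5 p"
    using pos by simp_all
  have "0 \<le> L2 m t p \<and> 0 \<le> L3 t p"
  proof (cases t)
    case 0
    then show ?thesis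
      using pos by simp
  next
    case (Suc t')
    then have "1 \<le> t"
      by simp
    from growth[unfolded growth_functions_def, THEN conjunct2, THEN conjunct1, rule_format, OF m this p]
    show ?thesis
      by simp
  qed
  then show "0 \<le> L2 m t p" "0 \<le> L3 t p"
    by simp_all
qed

lemma L_F_mono:
  assumes growth: "growth_functions L1 L2 L3 L4 L5" and m: "1 \<le> m" and p: "1 \<le> p" and t: "t \<le> t'"
  shows "L_F L1 L2 L3 m t p \<le> L_F L1 L2 L3 m t' p"
proof -
  from growth[unfolded growth_functions_def, THEN conjunct2, THEN conjunct2, THEN spec, THEN spec,
      THEN spec, THEN spec, THEN spec, THEN spec, of m m t t' p p]
  show ?thesis
    using m p t by (simp add: L_F_def)
qed

text \<open>At \<open>t = j * p\<close> the index \<open>t div p + 1\<close> is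
  \<open>Suc j\<close>; for \<open>p = 0\<close> it would always be 1.\<close>

lemma f_1_mult:
  assumes "1 \<le> p"
  shows "f_1 L1 L2 L3 m (j * p) p = inverse (bcgs_gamma (Suc j)) * L_F L1 L2 L3 m (j * p) p"
  using assms by (simp add: f_1_def)

lemma f_sing_mult:
  assumes "1 \<le> p"
  shows "f_sing L1 L2 L3 L5 m (j * p) p = f_1 L1 L2 L3 m (j * p) p + L_F L1 L2 L3 m (j * p) p
    + bcgs_gamma (Suc j) * L5 p"
  using assms by (simp add: f_sing_def)

subsection \<open>One step of BCGS2\<close>

text \<open>By the first pass, \<open>U\<^sup>T Q1 R1\<close> is a damped \<open>U\<^sup>T B\<close>
  plus rounding, which \<open>small\<close> bounds by \<open>\<epsilon> * norm2 B * f\<close>. The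
  bound on the inverse of the computed \<open>R\<close>, a perturbation of \<open>R2 R1\<close>,
  turns this into a comparison with \<open>R2\<close>. In the application \<open>f\<close> is
  \<open>f_1 + L_F\<close> and \<open>l\<close> is \<open>L5\<close>, the ingredients of
  \<open>f_sing\<close>.\<close>

lemma mult_le_of_R_diag:
  assumes U: "U \<in> carrier_mat m t" and B: "B \<in> carrier_mat m p" and Q1: "Q1 \<in> carrier_mat m p"
    and R1: "R1 \<in> carrier_mat p p" and R2: "R2 \<in> carrier_mat p p" and R: "R \<in> carrier_mat p p"
    and X: "mat_inverse R = Some X"
    and h: "orth_defect U \<le> h" and e1: "norm2 (cgs_error U B Q1 R1) \<le> e1"
    and RR: "norm2 (R2 * R1 - R) \<le> \<epsilon> * l * norm2 B"
    and cond: "\<epsilon> * (f + \<gamma> * l) * norm2 B * norm2 X \<le> \<gamma>"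
    and small: "h * ((1 + h) * norm2 B) + (1 + h) * e1 \<le> \<epsilon> * norm2 B * f"
    and pos: "0 < \<epsilon>" "0 < norm2 B" "0 < f" "0 \<le> l" "0 < \<gamma>"
    and v: "v \<in> carrier_vec p"
  shows "vnorm (U\<^sup>T *\<^sub>v (Q1 *\<^sub>v v)) \<le> \<gamma> * vnorm (R2 *\<^sub>v v)"
proof -
  have h0: "0 \<le> h"
    using h orth_defect_nonneg[of U] by linarith
  have UT: "U\<^sup>T \<in> carrier_mat t m"
    using U by simp
  have W: "U\<^sup>T * Q1 \<in> carrier_mat t p"
    using U Q1 by auto
  have Wv: "(U\<^sup>T * Q1) *\<^sub>v u = U\<^sup>T *\<^sub>v (Q1 *\<^sub>v u)" if "u \<in> carrier_vec p" for u
    using UT Q1 that by (rule assoc_mult_mat_vec)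
  have "vnorm ((U\<^sup>T * Q1) *\<^sub>v v) \<le> \<gamma> * vnorm (R2 *\<^sub>v v)"
  proof (rule mult_le_of_perturbed_inverse[OF R R1 R2 W _ _ _ pos(3,4,5)])
    show "X \<in> carrier_mat p p" "X * R = 1\<^sub>m p"
      using mat_inverse(2)[OF R X] by auto
    show "0 < \<epsilon> * norm2 B"
      using pos by simp
    show "norm2 (R2 * R1 - R) \<le> \<epsilon> * norm2 B * l"
      using RR by (simp add: mult_ac)
    show "\<epsilon> * norm2 B * norm2 X * (f + \<gamma> * l) \<le> \<gamma>"
      using cond by (simp add: mult_ac)
    fix u :: "real vec"
    assume u: "u \<in> carrier_vec p"
    have Bu: "B *\<^sub>v u \<in> carrier_vec m" and R1u: "R1 *\<^sub>v u \<in> carrier_vec p"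
      using B R1 u by auto
    have "vnorm (U\<^sup>T *\<^sub>v (B *\<^sub>v u)) \<le> (1 + h) * vnorm (B *\<^sub>v u)"
      using norm2_transpose_le[OF U] norm2_le_orth_defect[OF U h]
      by (intro vnorm_mult_mat_vec_le_trans[OF UT Bu]) linarith
    also have "\<dots> \<le> (1 + h) * (norm2 B * vnorm u)"
      using h0 vnorm_mult_mat_vec_le[OF B u] by (intro mult_left_mono) auto
    finally have *: "h * vnorm (U\<^sup>T *\<^sub>v (B *\<^sub>v u)) \<le> h * ((1 + h) * (norm2 B * vnorm u))"
      using h0 by (intro mult_left_mono)
    have "vnorm (U\<^sup>T *\<^sub>v (Q1 *\<^sub>v (R1 *\<^sub>v u)))
        \<le> h * vnorm (U\<^sup>T *\<^sub>v (B *\<^sub>v u)) + (1 + h) * e1 * vnorm u"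
      by (rule cgs_transpose_mult_le[OF U B Q1 R1 u h e1])
    also have "\<dots> \<le> (h * ((1 + h) * norm2 B) + (1 + h) * e1) * vnorm u"
      using * by (simp add: algebra_simps)
    also have "\<dots> \<le> \<epsilon> * norm2 B * f * vnorm u"
      using small by (rule mult_right_mono) simp
    finally show "vnorm ((U\<^sup>T * Q1) *\<^sub>v (R1 *\<^sub>v u)) \<le> \<epsilon> * norm2 B * f * vnorm u"
      using Wv[OF R1u] by simp
  qed (rule v)
  then show ?thesis
    by (simp add: Wv[OF v])
qed

text \<open>Here \<open>r\<close>, \<open>w\<close>, \<open>v\<close> are the lengths of
  \<open>R2 v\<close>, \<open>U\<^sup>T Q1 v\<close> and \<open>v\<close>. The constants fit because
  13/12 divided by 1 - 17/500 is below 121/100.\<close>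

lemma vnorm_le_of_pythagoras:
  assumes P: "\<bar>r\<^sup>2 + w\<^sup>2 - v\<^sup>2\<bar> \<le> 17 * \<eta> * v\<^sup>2" and \<eta>: "\<eta> \<le> 1 / 500"
    and w: "0 \<le> w" "w \<le> \<gamma> * r" and \<gamma>: "\<gamma>\<^sup>2 \<le> 1 / 12" and r: "0 \<le> (r :: real)"
  shows "v \<le> 11 / 10 * r"
proof -
  have "w\<^sup>2 \<le> (\<gamma> * r)\<^sup>2"
    using w by (intro power_mono)
  also have "\<dots> \<le> 1 / 12 * r\<^sup>2"
    using mult_right_mono[OF \<gamma>, of "r\<^sup>2"] by (simp add: power_mult_distrib)
  finally have "v\<^sup>2 - 17 * \<eta> * v\<^sup>2 \<le> 13 / 12 * r\<^sup>2"
    using P by linarith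
  moreover have "17 * \<eta> * v\<^sup>2 \<le> 17 / 500 * v\<^sup>2"
    using \<eta> by (intro mult_right_mono) auto
  ultimately have "v\<^sup>2 \<le> 121 / 100 * r\<^sup>2"
    using zero_le_power2[of r] by linarith
  then have "v\<^sup>2 \<le> (11 / 10 * r)\<^sup>2"
    by (simp add: power_mult_distrib power_divide)
  then show ?thesis
    by (rule power2_le_imp_le) (use r in simp)
qed

text \<open>An exact Pythagoras relation would give \<open>w \<le> \<gamma> * r\<close>. The
  perturbation costs \<open>17 * \<eta> * v\<^sup>2\<close>, at most
  \<open>34 * \<eta> * r\<^sup>2\<close>, and is paid for by passing from \<open>\<gamma>\<close> to
  the larger \<open>\<gamma>'\<close>.\<close>

lemma mult_le_of_R2:
  assumes P: "\<bar>r\<^sup>2 + w\<^sup>2 - v\<^sup>2\<bar> \<le> 17 * \<eta> * v\<^sup>2" and \<eta>: "0 \<le> \<eta>" "34 * \<eta> \<le> \<gamma>'\<^sup>2 - \<gamma>\<^sup>2"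
    and v: "0 \<le> v" "v \<le> sqrt (1 + \<gamma>\<^sup>2) * r" and \<gamma>: "\<gamma>\<^sup>2 \<le> 1" "0 \<le> \<gamma>'" and r: "0 \<le> (r :: real)"
  shows "w \<le> \<gamma>' * r"
proof -
  have "v\<^sup>2 \<le> (sqrt (1 + \<gamma>\<^sup>2) * r)\<^sup>2"
    using v by (intro power_mono)
  then have v2: "v\<^sup>2 \<le> (1 + \<gamma>\<^sup>2) * r\<^sup>2"
    by (simp add: power_mult_distrib)
  also have "\<dots> \<le> 2 * r\<^sup>2"
    using \<gamma> by (intro mult_right_mono) auto
  finally have "17 * \<eta> * v\<^sup>2 \<le> 34 * \<eta> * r\<^sup>2"
    using \<eta>(1) mult_left_mono[of "v\<^sup>2" "2 * r\<^sup>2" "17 * \<eta>"] by simp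
  also have "\<dots> \<le> (\<gamma>'\<^sup>2 - \<gamma>\<^sup>2) * r\<^sup>2"
    using \<eta>(2) by (intro mult_right_mono) auto
  finally have "w\<^sup>2 \<le> (\<gamma>' * r)\<^sup>2"
    using P v2 by (simp add: power_mult_distrib algebra_simps)
  then show ?thesis
    by (rule power2_le_imp_le) (use \<gamma> r in simp)
qed

text \<open>The choice of \<open>\<alpha>\<close>: \<open>2 (1 + sqrt 2)\<^sup>2 + 1 = 7 + 4 sqrt 2\<close> is exactly the increment
  of \<open>\<gamma>\<^sub>k\<^sup>-\<^sup>2\<close>.\<close>

lemma orth_defect_recursion:
  assumes "0 \<le> L'" "L' \<le> L" "0 \<le> c" "c \<le> L" "0 \<le> (\<epsilon> :: real)"
  shows "sqrt ((\<epsilon> * (inverse (bcgs_gamma (Suc j)) * L'))\<^sup>2 + 2 * (\<epsilon> * (1 + sqrt 2) * L)\<^sup>2 + (\<epsilon> * c)\<^sup>2)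
    \<le> \<epsilon> * (inverse (bcgs_gamma (Suc (Suc j))) * L)"
proof (rule real_le_lsqrt)
  have "(\<epsilon> * (inverse (bcgs_gamma (Suc j)) * L'))\<^sup>2 \<le> (\<epsilon> * (inverse (bcgs_gamma (Suc j)) * L))\<^sup>2"
    using assms bcgs_gamma_pos[of j] by (intro power_mono mult_left_mono) auto
  moreover have "(\<epsilon> * c)\<^sup>2 \<le> (\<epsilon> * L)\<^sup>2"
    using assms by (intro power_mono mult_left_mono) auto
  moreover have "(\<epsilon> * (inverse (bcgs_gamma (Suc j)) * L))\<^sup>2 + 2 * (\<epsilon> * (1 + sqrt 2) * L)\<^sup>2 + (\<epsilon> * L)\<^sup>2
      = (\<epsilon> * (inverse (bcgs_gamma (Suc (Suc j))) * L))\<^sup>2"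
  proof -
    have "(1 + sqrt 2)\<^sup>2 = 3 + 2 * sqrt 2"
      by (simp add: power2_sum)
    then show ?thesis
      by (simp only: power_mult_distrib inverse_bcgs_gamma_power2) (simp add: algebra_simps)
  qed
  ultimately show "(\<epsilon> * (inverse (bcgs_gamma (Suc j)) * L'))\<^sup>2 + 2 * (\<epsilon> * (1 + sqrt 2) * L)\<^sup>2 + (\<epsilon> * c)\<^sup>2
      \<le> (\<epsilon> * (inverse (bcgs_gamma (Suc (Suc j))) * L))\<^sup>2"
    by linarith
  show "0 \<le> \<epsilon> * (inverse (bcgs_gamma (Suc (Suc j))) * L)"
    using assms bcgs_gamma_pos[of "Suc j"] by simp
qed

text \<open>The carrier facts stand apart from the error bound because they need no accuracy. The
  free bound \<open>N\<close> allows for the second pass, whose argument \<open>Q1\<close> is only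
  known to have norm near 1; \<open>D'\<close> lets both passes share one constant.\<close>

lemma block_CGS_step_cgs_error:
  assumes dims: "dims_ok a m p" and U: "U \<in> carrier_mat m t" and B: "B \<in> carrier_mat m p"
    and step: "block_CGS_step a U B = (Q, R, S)"
  shows "Q \<in> carrier_mat m p" "R \<in> carrier_mat p p"
    and "\<lbrakk>block_CGS_step_bounds L1 L2 L3 m t p D \<epsilon> a U B; orth_defect U \<le> h; D \<le> D'; 0 \<le> D';
      0 \<le> \<epsilon>; 0 \<le> L1 m p; 0 \<le> L2 m t p; 0 \<le> L3 t p; norm2 B \<le> N\<rbrakk>
      \<Longrightarrow> orth_defect Q \<le> \<epsilon> * L1 m p \<and>
        norm2 (cgs_error U B Q R) \<le> (1 + h) * (\<epsilon> * L_F L1 L2 L3 m t p * N + 2 * D' * \<epsilon>\<^sup>2)"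
proof -
  define Y where "Y = fl_residual a U B S"
  have S_def: "S = fl_trans_mult a U B" and QR: "fl_local_qr a Y = (Q, R)"
    using step by (auto simp: block_CGS_step_def Let_def Y_def split: prod.splits)
  have S: "S \<in> carrier_mat t p"
    using dims U B unfolding dims_ok_def S_def by blast
  then have Y: "Y \<in> carrier_mat m p"
    using dims U B unfolding dims_ok_def Y_def by blast
  have QRc: "Q \<in> carrier_mat m p \<and> R \<in> carrier_mat p p"
    using bspec[OF conjunct1[OF dims[unfolded dims_ok_def]] Y] QR by simp
  then show Q: "Q \<in> carrier_mat m p" and R: "R \<in> carrier_mat p p"
    by auto
  assume bounds: "block_CGS_step_bounds L1 L2 L3 m t p D \<epsilon> a U B"
    and h: "orth_defect U \<le> h" and D: "D \<le> D'" "0 \<le> D'" and \<epsilon>: "0 \<le> \<epsilon>"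
    and L: "0 \<le> L1 m p" "0 \<le> L2 m t p" "0 \<le> L3 t p" and N: "norm2 B \<le> N"
  have h0: "0 \<le> h"
    using h orth_defect_nonneg[of U] by linarith
  have N0: "0 \<le> N"
    using N norm2_nonneg[of B] by linarith
  have D\<epsilon>: "D * \<epsilon>\<^sup>2 \<le> D' * \<epsilon>\<^sup>2"
    using D by (intro mult_right_mono) auto
  have mono: "\<epsilon> * l * norm2 B \<le> \<epsilon> * l * N" if "0 \<le> l" for l
    using N \<epsilon> that by (intro mult_left_mono) auto
  let ?x = "\<epsilon> * L2 m t p * N + D' * \<epsilon>\<^sup>2" and ?y = "\<epsilon> * L3 t p * N + D' * \<epsilon>\<^sup>2 + \<epsilon> * L1 m p * N"
  from bounds have "orth_defect Q \<le> \<epsilon> * L1 m p \<and> norm2 (Q * R - Y) \<le> \<epsilon> * L1 m p * norm2 B \<and>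
      norm2 (U\<^sup>T * B - S) \<le> \<epsilon> * L2 m t p * norm2 B + D * \<epsilon>\<^sup>2 \<and>
      norm2 (B - U * S - Y) \<le> \<epsilon> * L3 t p * norm2 B + D * \<epsilon>\<^sup>2"
    by (simp only: block_CGS_step_bounds_def step prod.case Let_def Y_def)
  then have b: "orth_defect Q \<le> \<epsilon> * L1 m p" "norm2 (Q * R - Y) \<le> \<epsilon> * L1 m p * N"
    "norm2 (U\<^sup>T * B - S) \<le> ?x" "norm2 (B - U * S - Y) \<le> \<epsilon> * L3 t p * N + D' * \<epsilon>\<^sup>2"
    using mono[OF L(1)] mono[OF L(2)] mono[OF L(3)] D\<epsilon> by linarith+
  have "norm2 U * norm2 (U\<^sup>T * B - S) \<le> (1 + h) * ?x"
    using norm2_le_orth_defect[OF U h] b(3) h0 by (intro mult_mono) auto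
  then have "norm2 (cgs_error U B Q R) \<le> (1 + h) * ?x + ?y"
    using norm2_cgs_error_le[OF U B Q R S Y] b by linarith
  \<comment> \<open>Only the error in \<open>S\<close> carries the factor \<open>1 + h\<close>;
    giving it to all terms lets \<open>L1\<close>, \<open>L2\<close> and \<open>L3\<close> combine
    to \<open>L_F\<close>.\<close>
  also have "\<dots> \<le> (1 + h) * ?x + (1 + h) * ?y"
  proof -
    have "0 \<le> h * ?y"
      using h0 N0 \<epsilon> L D by (intro mult_nonneg_nonneg add_nonneg_nonneg) auto
    then show ?thesis
      by (simp add: algebra_simps)
  qed
  also have "\<dots> = (1 + h) * (\<epsilon> * L_F L1 L2 L3 m t p * N + 2 * D' * \<epsilon>\<^sup>2)"
    by (simp add: L_F_def algebra_simps)
  finally show "orth_defect Q \<le> \<epsilon> * L1 m p \<and>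
      norm2 (cgs_error U B Q R) \<le> (1 + h) * (\<epsilon> * L_F L1 L2 L3 m t p * N + 2 * D' * \<epsilon>\<^sup>2)"
    using b(1) by simp
qed

section \<open>Inequalities that hold for all small \<open>\<epsilon>\<close>\<close>

lemma eventually_less_at_right_0:
  fixes g :: "real \<Rightarrow> real"
  assumes "isCont g 0" "g 0 < c"
  shows "\<forall>\<^sub>F x in at_right 0. g x < c"
proof -
  have "(g \<longlongrightarrow> g 0) (at_right 0)"
    using assms(1) unfolding isCont_def by (rule tendsto_within_subset) auto
  then show ?thesis
    using assms(2) by (rule order_tendstoD(2))
qed

text \<open>The factor \<open>1 + sqrt 2\<close> in \<open>\<alpha>\<close> leaves room (\<open>11/10 < sqrt 2\<close>) and so does \<open>G' < G\<close>: this absorbs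
  all terms of order \<open>\<epsilon>\<^sup>2\<close>.\<close>

lemma eventually_rounding_small:
  fixes G G' L c N D \<eta> :: real
  assumes L: "0 < L" and N: "0 < N" and G: "G' < G" and \<eta>: "0 < \<eta>"
  shows "\<forall>\<^sub>F \<epsilon> in at_right 0. 0 < \<epsilon> \<and> \<epsilon> * G < 1 \<and> \<epsilon> * G' \<le> \<eta> \<and> \<epsilon> * c \<le> \<eta> \<and>
    (1 + \<epsilon> * G') * (\<epsilon> * L * (1 + \<epsilon> * c) + 2 * D * \<epsilon>\<^sup>2) \<le> \<eta> \<and>
    \<epsilon> * G' * ((1 + \<epsilon> * G') * N) + (1 + \<epsilon> * G') * ((1 + \<epsilon> * G') * (\<epsilon> * L * N + 2 * D * \<epsilon>\<^sup>2))
      \<le> \<epsilon> * N * (G + L) \<and>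
    (1 + \<epsilon> * G') * ((1 + \<epsilon> * G') * (\<epsilon> * L * (1 + \<epsilon> * c) + 2 * D * \<epsilon>\<^sup>2)) * (11 / 10)
      \<le> \<epsilon> * (sqrt 2 * L)"
proof -
  have root: "11 / 10 < sqrt (2 :: real)"
    by (rule real_less_rsqrt) (simp add: power_divide)
  have "\<forall>\<^sub>F \<epsilon> in at_right 0. 0 < (\<epsilon> :: real)"
    by (simp add: eventually_at_right_less)
  moreover have "\<forall>\<^sub>F \<epsilon> in at_right 0. \<epsilon> * G < 1"
    by (rule eventually_less_at_right_0) (auto intro!: continuous_intros)
  moreover have "\<forall>\<^sub>F \<epsilon> in at_right 0. \<epsilon> * G' < \<eta>"
    using \<eta> by (intro eventually_less_at_right_0) (auto intro!: continuous_intros)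
  moreover have "\<forall>\<^sub>F \<epsilon> in at_right 0. \<epsilon> * c < \<eta>"
    using \<eta> by (intro eventually_less_at_right_0) (auto intro!: continuous_intros)
  moreover have "\<forall>\<^sub>F \<epsilon> in at_right 0.
      (1 + \<epsilon> * G') * (\<epsilon> * L * (1 + \<epsilon> * c) + 2 * D * \<epsilon>\<^sup>2) < \<eta>"
    using \<eta> by (intro eventually_less_at_right_0) (auto intro!: continuous_intros)
  \<comment> \<open>Here and in the next inequality a factor \<open>\<epsilon>\<close> is divided
    out, since both sides of the original vanish at 0. What remains at 0 is strict:
    \<open>G' * N + L * N < N * (G + L)\<close>, and below it
    \<open>L * (11 / 10) < sqrt 2 * L\<close>.\<close>
  moreover have "\<forall>\<^sub>F \<epsilon> in at_right 0. G' * ((1 + \<epsilon> * G') * N) +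
      (1 + \<epsilon> * G') * ((1 + \<epsilon> * G') * (L * N + 2 * D * \<epsilon>)) < N * (G + L)"
    using N G by (intro eventually_less_at_right_0) (auto intro!: continuous_intros simp: algebra_simps)
  moreover have "\<forall>\<^sub>F \<epsilon> in at_right 0.
      (1 + \<epsilon> * G') * ((1 + \<epsilon> * G') * (L * (1 + \<epsilon> * c) + 2 * D * \<epsilon>)) * (11 / 10) < sqrt 2 * L"
    using root L by (intro eventually_less_at_right_0) (auto intro!: continuous_intros)
  ultimately show ?thesis
  proof eventually_elim
    case (elim \<epsilon>)
    have pull: "\<epsilon> * x * y + \<epsilon> * z = \<epsilon> * (x * y + z)" "k * (k * (\<epsilon> * x * y + 2 * D * \<epsilon>\<^sup>2))
        = \<epsilon> * (k * (k * (x * y + 2 * D * \<epsilon>)))" for k x y z :: real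
      by (simp_all add: power2_eq_square algebra_simps)
    have "\<epsilon> * (G' * ((1 + \<epsilon> * G') * N) + (1 + \<epsilon> * G') * ((1 + \<epsilon> * G') * (L * N + 2 * D * \<epsilon>)))
        \<le> \<epsilon> * (N * (G + L))"
      "\<epsilon> * ((1 + \<epsilon> * G') * ((1 + \<epsilon> * G') * (L * (1 + \<epsilon> * c) + 2 * D * \<epsilon>)) * (11 / 10))
        \<le> \<epsilon> * (sqrt 2 * L)"
      by (rule mult_left_mono[OF less_imp_le[OF elim(6)] less_imp_le[OF elim(1)]],
          rule mult_left_mono[OF less_imp_le[OF elim(7)] less_imp_le[OF elim(1)]])
    then show ?case
      unfolding pull mult.assoc[of \<epsilon> _ "11 / 10"] mult.assoc[of \<epsilon> N]
      by (intro conjI elim(1,2) elim(3,4,5)[THEN less_imp_le])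
  qed
qed

subsection \<open>Loss of orthogonality along the run\<close>

text \<open>The induction step towards \<open>k = i + 2\<close> at one fixed
  \<open>\<epsilon>\<close>; all asymptotics sit in the assumptions on \<open>\<eta>\<close> and in
  \<open>small\<close>. \<open>G'\<close> and \<open>G\<close> are the values of \<open>f_1\<close>
  before and after the step.\<close>

lemma BCGS2_step_orth_defect:
  fixes L1 L3 :: "nat \<Rightarrow> nat \<Rightarrow> real" and L2 :: "nat \<Rightarrow> nat \<Rightarrow> nat \<Rightarrow> real" and L5 :: "nat \<Rightarrow> real"
    and A :: "real mat" and a :: fp_arith and \<epsilon> :: real and i m p :: nat
  defines "U \<equiv> Qhat a p A (Suc i)" and "B \<equiv> col_block p A (Suc (Suc i))"
    and "\<gamma> \<equiv> bcgs_gamma (Suc (Suc i))" and "\<gamma>' \<equiv> bcgs_gamma (Suc i)"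
    and "L \<equiv> L_F L1 L2 L3 m (Suc i * p) p" and "L' \<equiv> L_F L1 L2 L3 m (i * p) p"
  defines "G \<equiv> inverse \<gamma> * L" and "G' \<equiv> inverse \<gamma>' * L'"
  assumes p: "1 \<le> p" and B: "B \<in> carrier_mat m p" and N: "0 < norm2 B"
    and L: "0 < L1 m p" "0 \<le> L2 m (Suc i * p) p" "0 \<le> L3 (Suc i * p) p" "0 \<le> L'" "L' \<le> L" "0 < L5 p"
    and dims: "dims_ok a m p"
    and U: "U \<in> carrier_mat m (Suc i * p)" and dU: "orth_defect U \<le> \<epsilon> * G'"
    and acc1: "block_CGS_step_bounds L1 L2 L3 m (Suc i * p) p D1 \<epsilon> a U B"
    and acc2: "block_CGS_step_bounds L1 L2 L3 m (Suc i * p) p D2 \<epsilon> a U (fst (first_CGS_step a U B))"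
    and acc3: "block_CGS2_step_bounds L4 L5 p \<epsilon> a U B"
    and D: "D1 \<le> D" "D2 \<le> D" "0 \<le> D"
    and \<eta>: "0 \<le> \<eta>" "\<eta> \<le> 1 / 500" "34 * \<eta> \<le> \<gamma>'\<^sup>2 - \<gamma>\<^sup>2"
    and small: "0 < \<epsilon>" "\<epsilon> * G' \<le> \<eta>" "\<epsilon> * L1 m p \<le> \<eta>"
      "(1 + \<epsilon> * G') * (\<epsilon> * L * (1 + \<epsilon> * L1 m p) + 2 * D * \<epsilon>\<^sup>2) \<le> \<eta>"
      "\<epsilon> * G' * ((1 + \<epsilon> * G') * norm2 B)
        + (1 + \<epsilon> * G') * ((1 + \<epsilon> * G') * (\<epsilon> * L * norm2 B + 2 * D * \<epsilon>\<^sup>2)) \<le> \<epsilon> * norm2 B * (G + L)"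
      "(1 + \<epsilon> * G') * ((1 + \<epsilon> * G') * (\<epsilon> * L * (1 + \<epsilon> * L1 m p) + 2 * D * \<epsilon>\<^sup>2)) * (11 / 10)
        \<le> \<epsilon> * (sqrt 2 * L)"
    and cond: "R_diag_condition L1 L2 L3 L5 m p A \<epsilon> a (Suc (Suc i)) \<or> R2_condition p A a (Suc (Suc i))"
  shows "Qhat a p A (Suc (Suc i)) \<in> carrier_mat m (Suc (Suc i) * p)"
    and "orth_defect (Qhat a p A (Suc (Suc i))) \<le> \<epsilon> * G"
proof -
  let ?h = "\<epsilon> * G'" and ?e1 = "(1 + \<epsilon> * G') * (\<epsilon> * L * norm2 B + 2 * D * \<epsilon>\<^sup>2)"
    and ?e2 = "(1 + \<epsilon> * G') * (\<epsilon> * L * (1 + \<epsilon> * L1 m p) + 2 * D * \<epsilon>\<^sup>2)"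
  have \<gamma>: "0 < \<gamma>" "0 < \<gamma>'" "\<gamma> < \<gamma>'" "\<gamma>\<^sup>2 \<le> 1 / 12"
    unfolding \<gamma>_def \<gamma>'_def
    by (rule bcgs_gamma_pos bcgs_gamma_Suc_less bcgs_gamma_power2_le)+
  have L_pos: "0 < L"
    using L by (simp add: L_def L_F_def)
  obtain Q1 R1 S1 where s1: "block_CGS_step a U B = (Q1, R1, S1)"
    by (rule prod_cases3)
  obtain Q R2 S2 where s2: "block_CGS_step a U Q1 = (Q, R2, S2)"
    by (rule prod_cases3)
  note f1 = s1[folded first_CGS_step_def]
  note factors = BCGS2_Suc_factors[OF f1[unfolded U_def B_def] s2[unfolded U_def], folded U_def]
  note e1 = block_CGS_step_cgs_error[OF dims U B s1]
  have Q1: "Q1 \<in> carrier_mat m p" and R1: "R1 \<in> carrier_mat p p"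
    by (rule e1(1), rule e1(2))
  have 1: "orth_defect Q1 \<le> \<epsilon> * L1 m p \<and> norm2 (cgs_error U B Q1 R1) \<le> ?e1"
    unfolding L_def
    by (rule e1(3)[OF acc1 dU D(1,3) less_imp_le[OF small(1)] less_imp_le[OF L(1)] L(2,3) order_refl])
  note e2 = block_CGS_step_cgs_error[OF dims U Q1 s2]
  have Q: "Q \<in> carrier_mat m p" and R2: "R2 \<in> carrier_mat p p"
    by (rule e2(1), rule e2(2))
  have N1: "norm2 Q1 \<le> 1 + \<epsilon> * L1 m p"
    using 1 by (intro norm2_le_orth_defect[OF Q1]) simp
  have acc2': "block_CGS_step_bounds L1 L2 L3 m (Suc i * p) p D2 \<epsilon> a U Q1"
    using acc2 unfolding f1 by (simp only: fst_conv)
  have 2: "orth_defect Q \<le> \<epsilon> * L1 m p \<and> norm2 (cgs_error U Q1 Q R2) \<le> ?e2"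
    unfolding L_def
    by (rule e2(3)[OF acc2' dU D(2,3) less_imp_le[OF small(1)] less_imp_le[OF L(1)] L(2,3) N1])
  have R: "fl_comb_R a R2 R1 \<in> carrier_mat p p"
    using dims R1 R2 unfolding dims_ok_def by blast
  have RR: "norm2 (R2 * R1 - fl_comb_R a R2 R1) \<le> \<epsilon> * L5 p * norm2 B"
    using acc3 s1 s2
    by (simp add: block_CGS2_step_bounds_def second_CGS_step_def first_CGS_step_def
        block_CGS2_step_def Let_def)
  have pyth: "\<bar>(vnorm (R2 *\<^sub>v v))\<^sup>2 + (vnorm (U\<^sup>T *\<^sub>v (Q1 *\<^sub>v v)))\<^sup>2 - (vnorm v)\<^sup>2\<bar>
      \<le> 17 * \<eta> * (vnorm v)\<^sup>2" if "v \<in> carrier_vec p" for v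
    using 1 2 dU small \<eta> by (intro cgs_pythagoras[OF U Q1 Q R2 that]) linarith+
  \<comment> \<open>Both alternatives lead to the same two bounds. The constant
    \<open>\<gamma>'\<close> of the previous step is good enough, because the incoming defect bound
    contains its inverse.\<close>
  have WV: "vnorm (U\<^sup>T *\<^sub>v (Q1 *\<^sub>v v)) \<le> \<gamma>' * vnorm (R2 *\<^sub>v v) \<and> vnorm v \<le> 11 / 10 * vnorm (R2 *\<^sub>v v)"
    if v: "v \<in> carrier_vec p" for v
    using cond
  proof
    assume "R_diag_condition L1 L2 L3 L5 m p A \<epsilon> a (Suc (Suc i))"
    then obtain X where X: "mat_inverse (fl_comb_R a R2 R1) = Some X"
      and c: "\<epsilon> * f_sing L1 L2 L3 L5 m (Suc i * p) p * norm2 B * norm2 X \<le> \<gamma>"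
      by (auto simp: R_diag_condition_def factors B_def \<gamma>_def)
    have fs: "f_sing L1 L2 L3 L5 m (Suc i * p) p = (G + L) + \<gamma> * L5 p"
      using p by (simp add: f_sing_mult f_1_mult G_def L_def \<gamma>_def del: mult_Suc)
    have "0 < G + L"
      using L_pos \<gamma> by (simp add: G_def add_pos_pos)
    then have W: "vnorm (U\<^sup>T *\<^sub>v (Q1 *\<^sub>v v)) \<le> \<gamma> * vnorm (R2 *\<^sub>v v)"
      using mult_le_of_R_diag[OF U B Q1 R1 R2 R X dU conjunct2[OF 1] RR c[unfolded fs] small(5,1) N _ _ \<gamma>(1) v]
        L by simp
    have "\<gamma> * vnorm (R2 *\<^sub>v v) \<le> \<gamma>' * vnorm (R2 *\<^sub>v v)"
      using \<gamma> by (intro mult_right_mono) auto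
    then show ?thesis
      using W vnorm_le_of_pythagoras[OF pyth[OF v] \<eta>(2) _ W \<gamma>(4)] by simp
  next
    assume "R2_condition p A a (Suc (Suc i))"
    then obtain X where X: "mat_inverse R2 = Some X" and c: "norm2 X \<le> sqrt (1 + \<gamma>\<^sup>2)"
      by (auto simp: R2_condition_def factors \<gamma>_def powr_half_sqrt add_nonneg_nonneg)
    have Xc: "X \<in> carrier_mat p p" and XR: "X * R2 = 1\<^sub>m p"
      using mat_inverse(2)[OF R2 X] by auto
    have R2v: "R2 *\<^sub>v v \<in> carrier_vec p"
      using R2 v by auto
    have "v = X *\<^sub>v (R2 *\<^sub>v v)"
      using R2 Xc XR v by (metis assoc_mult_mat_vec one_mult_mat_vec)
    then have V: "vnorm v \<le> sqrt (1 + \<gamma>\<^sup>2) * vnorm (R2 *\<^sub>v v)"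
      using vnorm_mult_mat_vec_le_trans[OF Xc R2v c] by simp
    \<comment> \<open>Since 13/12 is below 121/100.\<close>
    have "sqrt (1 + \<gamma>\<^sup>2) \<le> 11 / 10"
      using \<gamma>(4) by (intro real_le_lsqrt) (auto simp: power_divide)
    then have "sqrt (1 + \<gamma>\<^sup>2) * vnorm (R2 *\<^sub>v v) \<le> 11 / 10 * vnorm (R2 *\<^sub>v v)"
      by (rule mult_right_mono) simp
    moreover have "vnorm (U\<^sup>T *\<^sub>v (Q1 *\<^sub>v v)) \<le> \<gamma>' * vnorm (R2 *\<^sub>v v)"
      using \<gamma> by (intro mult_le_of_R2[OF pyth[OF v] \<eta>(1,3) _ V]) auto
    ultimately show ?thesis
      using V by linarith
  qed
  \<comment> \<open>In the first summand \<open>\<gamma>'\<close> cancels against \<open>G'\<close>,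
    leaving the 1 of \<open>1 + sqrt 2\<close>; the rounding errors of the second pass make up the
    \<open>sqrt 2\<close>.\<close>
  have "norm2 (U\<^sup>T * Q) \<le> ?h * \<gamma>' + (1 + ?h) * ?e2 * (11 / 10)"
    using 2 WV \<gamma> by (intro norm2_transpose_mult_le[OF U Q1 Q R2 dU]) auto
  also have "?h * \<gamma>' = \<epsilon> * L'"
    using \<gamma> by (simp add: G'_def)
  also have "\<dots> + (1 + ?h) * ?e2 * (11 / 10) \<le> \<epsilon> * L + \<epsilon> * (sqrt 2 * L)"
    using small(1,6) L by (intro add_mono mult_left_mono) auto
  also have "\<dots> = \<epsilon> * (1 + sqrt 2) * L"
    by (simp add: algebra_simps)
  finally have b: "norm2 (U\<^sup>T * Q) \<le> \<epsilon> * (1 + sqrt 2) * L" .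
  show "Qhat a p A (Suc (Suc i)) \<in> carrier_mat m (Suc (Suc i) * p)"
    using hcat_carrier[OF U Q] by (simp add: factors add_ac)
  have "orth_defect (hcat U Q)
      \<le> sqrt ((\<epsilon> * G')\<^sup>2 + 2 * (\<epsilon> * (1 + sqrt 2) * L)\<^sup>2 + (\<epsilon> * L1 m p)\<^sup>2)"
    by (rule orth_defect_hcat_le[OF U Q dU b conjunct1[OF 2]])
  also have "\<dots> \<le> \<epsilon> * G"
    unfolding G'_def G_def \<gamma>_def \<gamma>'_def
    using L small(1) by (intro orth_defect_recursion) (auto simp: L_def L_F_def)
  finally show "orth_defect (Qhat a p A (Suc (Suc i))) \<le> \<epsilon> * G"
    by (simp add: factors)
qed

lemma col_block_carrier:
  assumes "A \<in> carrier_mat m n"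
  shows "col_block p A k \<in> carrier_mat m p"
  using assms by (auto simp: col_block_def)

text \<open>Second-order terms can be absorbed into multiples of \<open>\<epsilon> * norm2 B\<close>
  only if the block \<open>B\<close> is nonzero; full column rank enters here.\<close>

lemma norm2_col_block_pos:
  assumes A: "A \<in> carrier_mat m n" and rank: "vec_space.rank m A = n"
    and p: "1 \<le> p" and k: "1 \<le> k" "k * p \<le> n"
  shows "0 < norm2 (col_block p A k)"
proof (rule norm2_pos[OF col_block_carrier[OF A], of 0])
  have "(k - 1) * p + p = k * p"
    using k by (cases k) auto
  then have j: "(k - 1) * p < n"
    using p k by linarith
  have "col (col_block p A k) 0 = col A ((k - 1) * p)"
    using A j p by (intro eq_vecI) (auto simp: col_block_def)
  then show "col (col_block p A k) 0 \<noteq> 0\<^sub>v m"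
    using full_rank_col_nonzero[OF A rank j] by simp
qed (use p in simp)

text \<open>Induction on \<open>j = k - 1\<close>, with the dimensions carried along. The bound has
  no second-order term, so no constants accumulate. The singularity alternative is posed separately
  for each step, which is weaker than the hypothesis of the theorem.\<close>

lemma eventually_orth_defect_Qhat:
  fixes L1 L3 :: "nat \<Rightarrow> nat \<Rightarrow> real" and L2 :: "nat \<Rightarrow> nat \<Rightarrow> nat \<Rightarrow> real" and L4 L5 :: "nat \<Rightarrow> real"
  assumes p: "1 \<le> p" and n: "n = s * p" "n \<le> m"
    and A: "A \<in> carrier_mat m n" "vec_space.rank m A = n"
    and growth: "growth_functions L1 L2 L3 L4 L5"
    and model: "BCGS2_error_model L1 L2 L3 L4 L5 m p s A a"
    and j: "Suc j \<le> s"
  shows "\<forall>\<^sub>F \<epsilon> in at_right 0.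
      (\<forall>k \<in> {2..s}. R_diag_condition L1 L2 L3 L5 m p A \<epsilon> (a \<epsilon>) k \<or> R2_condition p A (a \<epsilon>) k) \<longrightarrow>
      Qhat (a \<epsilon>) p A (Suc j) \<in> carrier_mat m (Suc j * p) \<and>
      orth_defect (Qhat (a \<epsilon>) p A (Suc j)) \<le> \<epsilon> * f_1 L1 L2 L3 m (j * p) p"
  using j
proof (induction j)
  case 0
  have m: "1 \<le> m"
    using p n 0 by (cases s) auto
  have L: "0 \<le> L2 m 0 p" "0 \<le> L3 0 p"
    by (rule growth_functions_nonneg[OF growth m p])+
  have "\<forall>\<^sub>F \<epsilon> in at_right 0. dims_ok (a \<epsilon>) m p \<and> local_qr_accurate L1 m p \<epsilon> (a \<epsilon>)"
    by (rule model[unfolded BCGS2_error_model_def, THEN conjunct1])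
  moreover have "\<forall>\<^sub>F \<epsilon> in at_right 0. 0 < (\<epsilon> :: real)"
    by (simp add: eventually_at_right_less)
  ultimately show ?case
  proof eventually_elim
    case (elim \<epsilon>)
    have B: "col_block p A 1 \<in> carrier_mat m p"
      by (rule col_block_carrier[OF A(1)])
    obtain Q R where QR: "fl_local_qr (a \<epsilon>) (col_block p A 1) = (Q, R)"
      by (rule prod.exhaust)
    have "Q \<in> carrier_mat m p"
      using QR bspec[OF conjunct1[OF elim(1)[THEN conjunct1, unfolded dims_ok_def]] B] by simp
    moreover have "orth_defect Q \<le> \<epsilon> * L1 m p"
      using QR bspec[OF elim(1)[THEN conjunct2, unfolded local_qr_accurate_def] B] by simp
    \<comment> \<open>At \<open>t = 0\<close> the factor \<open>inverse (bcgs_gamma 1)\<close> is 1,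
      and \<open>L_F\<close> contains \<open>L1\<close>.\<close>
    moreover have "\<epsilon> * L1 m p \<le> \<epsilon> * f_1 L1 L2 L3 m (0 * p) p"
      using elim L p by (intro mult_left_mono) (auto simp: f_1_def L_F_def)
    ultimately show ?case
      using QR by (simp add: Qhat_1)
  qed
next
  case (Suc i)
  let ?B = "col_block p A (Suc (Suc i))" and ?U = "\<lambda>\<epsilon>. Qhat (a \<epsilon>) p A (Suc i)" and ?t = "Suc i * p"
  let ?\<gamma> = "bcgs_gamma (Suc (Suc i))" and ?\<gamma>' = "bcgs_gamma (Suc i)"
  let ?L = "L_F L1 L2 L3 m ?t p" and ?L' = "L_F L1 L2 L3 m (i * p) p"
  let ?G = "inverse ?\<gamma> * ?L" and ?G' = "inverse ?\<gamma>' * ?L'"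
  have m: "1 \<le> m"
    using p n Suc.prems by (cases s) auto
  have L: "0 < L1 m p" "0 \<le> L2 m ?t p" "0 \<le> L3 ?t p" "0 < L5 p"
    by (rule growth_functions_nonneg[OF growth m p])+
  have "0 \<le> L2 m (i * p) p" "0 \<le> L3 (i * p) p"
    by (rule growth_functions_nonneg[OF growth m p])+
  then have L': "0 \<le> ?L'"
    using L by (simp add: L_F_def)
  have LL: "?L' \<le> ?L"
    by (rule L_F_mono[OF growth m p]) simp
  have L_pos: "0 < ?L"
    using L by (simp add: L_F_def)
  have \<gamma>: "0 < ?\<gamma>" "0 < ?\<gamma>'" "?\<gamma> < ?\<gamma>'"
    by (rule bcgs_gamma_pos bcgs_gamma_Suc_less)+
  have "?G' \<le> inverse ?\<gamma>' * ?L"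
    using LL \<gamma> by (intro mult_left_mono) auto
  also have "\<dots> < ?G"
    using \<gamma> L_pos by (intro mult_strict_right_mono) (auto simp: less_imp_inverse_less)
  finally have G: "?G' < ?G" .
  have f1: "f_1 L1 L2 L3 m ?t p = ?G" "f_1 L1 L2 L3 m (i * p) p = ?G'"
    using p by (simp_all only: f_1_mult)
  have kp: "Suc (Suc i) * p \<le> n"
    unfolding n(1) using Suc.prems by (rule mult_le_mono1)
  have N: "0 < norm2 ?B"
    by (rule norm2_col_block_pos[OF A p _ kp]) simp
  have k: "Suc (Suc i) \<in> {2..s}"
    using Suc.prems by simp
  have acc: "block_CGS_step_accurate L1 L2 L3 m ?t p a ?U (\<lambda>\<epsilon>. ?B)"
    "block_CGS_step_accurate L1 L2 L3 m ?t p a ?U (\<lambda>\<epsilon>. fst (first_CGS_step (a \<epsilon>) (?U \<epsilon>) ?B))"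
    "\<forall>\<^sub>F \<epsilon> in at_right 0. block_CGS2_step_bounds L4 L5 p \<epsilon> (a \<epsilon>) (?U \<epsilon>) ?B"
    using bspec[OF conjunct2[OF model[unfolded BCGS2_error_model_def Let_def]] k]
    by (simp_all only: diff_Suc_1)
  \<comment> \<open>The contracts are used with implied constant \<open>C = 0\<close>, as the
    induction hypothesis permits.\<close>
  obtain D1 where acc1: "\<forall>\<^sub>F \<epsilon> in at_right 0. orth_defect (?U \<epsilon>) \<le> \<epsilon> * ?G + 0 * \<epsilon>\<^sup>2 \<and>
      \<epsilon> * ?G + 0 * \<epsilon>\<^sup>2 < 1 \<longrightarrow> block_CGS_step_bounds L1 L2 L3 m ?t p D1 \<epsilon> (a \<epsilon>) (?U \<epsilon>) ?B"
    using acc(1) unfolding block_CGS_step_accurate_def f1 by blast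
  obtain D2 where acc2: "\<forall>\<^sub>F \<epsilon> in at_right 0. orth_defect (?U \<epsilon>) \<le> \<epsilon> * ?G + 0 * \<epsilon>\<^sup>2 \<and>
      \<epsilon> * ?G + 0 * \<epsilon>\<^sup>2 < 1 \<longrightarrow> block_CGS_step_bounds L1 L2 L3 m ?t p D2 \<epsilon> (a \<epsilon>) (?U \<epsilon>)
        (fst (first_CGS_step (a \<epsilon>) (?U \<epsilon>) ?B))"
    using acc(2) unfolding block_CGS_step_accurate_def f1 by blast
  \<comment> \<open>The constants of the contracts may be negative; the 0 keeps \<open>D\<close>
    usable as a monotone upper bound.\<close>
  define D where "D = max 0 (max D1 D2)"
  have D: "D1 \<le> D" "D2 \<le> D" "0 \<le> D"
    by (auto simp: D_def)
  \<comment> \<open>The first entry serves \<open>vnorm_le_of_pythagoras\<close>, the second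
    \<open>mult_le_of_R2\<close>; it is positive because \<open>bcgs_gamma\<close> decreases
    strictly.\<close>
  define \<eta> where "\<eta> = min (1 / 500) ((?\<gamma>'\<^sup>2 - ?\<gamma>\<^sup>2) / 34)"
  have "?\<gamma>\<^sup>2 < ?\<gamma>'\<^sup>2"
    using \<gamma> by (intro power_strict_mono) auto
  then have \<eta>: "0 < \<eta>" "\<eta> \<le> 1 / 500" "34 * \<eta> \<le> ?\<gamma>'\<^sup>2 - ?\<gamma>\<^sup>2"
    by (auto simp: \<eta>_def min_def)
  have dims: "\<forall>\<^sub>F \<epsilon> in at_right 0. dims_ok (a \<epsilon>) m p \<and> local_qr_accurate L1 m p \<epsilon> (a \<epsilon>)"
    by (rule model[unfolded BCGS2_error_model_def, THEN conjunct1])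
  have IH: "\<forall>\<^sub>F \<epsilon> in at_right 0.
      (\<forall>k \<in> {2..s}. R_diag_condition L1 L2 L3 L5 m p A \<epsilon> (a \<epsilon>) k \<or> R2_condition p A (a \<epsilon>) k) \<longrightarrow>
      ?U \<epsilon> \<in> carrier_mat m ?t \<and> orth_defect (?U \<epsilon>) \<le> \<epsilon> * ?G'"
    using Suc by (simp only: f1 Suc_leD)
  from IH dims acc1 acc2 acc(3) eventually_rounding_small[OF L_pos N G \<eta>(1), of "L1 m p" D]
  show ?case
    unfolding f1
  proof eventually_elim
    case (elim \<epsilon>)
    show ?case
    proof
      assume hyp: "\<forall>k \<in> {2..s}. R_diag_condition L1 L2 L3 L5 m p A \<epsilon> (a \<epsilon>) k \<or> R2_condition p A (a \<epsilon>) k"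
      have U: "?U \<epsilon> \<in> carrier_mat m ?t" and dU: "orth_defect (?U \<epsilon>) \<le> \<epsilon> * ?G'"
        using elim(1) hyp by auto
      \<comment> \<open>The contracts ask for the defect bound with \<open>f_1\<close> of the
        current step, whereas the induction hypothesis gives the smaller one of the previous
        step.\<close>
      have "\<epsilon> * ?G' \<le> \<epsilon> * ?G"
        using elim(6) G by (intro mult_left_mono) auto
      then have pre: "orth_defect (?U \<epsilon>) \<le> \<epsilon> * ?G + 0 * \<epsilon>\<^sup>2 \<and> \<epsilon> * ?G + 0 * \<epsilon>\<^sup>2 < 1"
        using order_trans[OF dU] elim(6) by simp
      show "Qhat (a \<epsilon>) p A (Suc (Suc i)) \<in> carrier_mat m (Suc (Suc i) * p) \<and>
          orth_defect (Qhat (a \<epsilon>) p A (Suc (Suc i))) \<le> \<epsilon> * ?G"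
        using BCGS2_step_orth_defect[where i = i and D = D and ?D1.0 = D1 and ?D2.0 = D2 and \<eta> = \<eta>,
            OF p col_block_carrier[OF A(1)] N L(1,2,3) L' LL L(4) conjunct1[OF elim(2)] U dU
              elim(3)[rule_format, OF pre] elim(4)[rule_format, OF pre] elim(5)]
          \<eta>(2,3) less_imp_le[OF \<eta>(1)] D elim(6) hyp[rule_format, OF k]
        by blast
    qed
  qed
qed

theorem theorem3p4:
  fixes m n p s :: nat
    and A :: "real mat"
    and a :: "real \<Rightarrow> fp_arith"
    and L1 L3 :: "nat \<Rightarrow> nat \<Rightarrow> real"
    and L2 :: "nat \<Rightarrow> nat \<Rightarrow> nat \<Rightarrow> real"
    and L4 L5 :: "nat \<Rightarrow> real"
  assumes "1 \<le> p" "1 \<le> s" "n = s * p" "n \<le> m"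
    and "A \<in> carrier_mat m n" "vec_space.rank m A = n"
    and "growth_functions L1 L2 L3 L4 L5"
    and "BCGS2_error_model L1 L2 L3 L4 L5 m p s A a"
  defines "hyp \<equiv> \<lambda>\<epsilon>.
      (\<forall>k \<in> {1..s}. \<epsilon> * f_1 L1 L2 L3 m ((k - 1) * p) p < 1) \<and>
      ((\<forall>k \<in> {2..s}. R_diag_condition L1 L2 L3 L5 m p A \<epsilon> (a \<epsilon>) k) \<or>
       (\<forall>k \<in> {2..s}. R2_condition p A (a \<epsilon>) k))"
  shows "(\<forall>k \<in> {1..s}. \<exists>C. \<forall>\<^sub>F \<epsilon> in at_right 0. hyp \<epsilon> \<longrightarrow>
            norm2 (1\<^sub>m (k * p) - (Qhat (a \<epsilon>) p A k)\<^sup>T * Qhat (a \<epsilon>) p A k)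
              \<le> \<epsilon> * f_1 L1 L2 L3 m ((k - 1) * p) p + C * \<epsilon>\<^sup>2) \<and>
         (\<exists>C. \<forall>\<^sub>F \<epsilon> in at_right 0. hyp \<epsilon> \<longrightarrow>
            norm2 (1\<^sub>m n - (Qhat (a \<epsilon>) p A s)\<^sup>T * Qhat (a \<epsilon>) p A s)
              \<le> \<epsilon> * f_1 L1 L2 L3 m ((s - 1) * p) p + C * \<epsilon>\<^sup>2)"
proof -
  have main: "\<exists>C. \<forall>\<^sub>F \<epsilon> in at_right 0. hyp \<epsilon> \<longrightarrow>
      norm2 (1\<^sub>m (k * p) - (Qhat (a \<epsilon>) p A k)\<^sup>T * Qhat (a \<epsilon>) p A k)
        \<le> \<epsilon> * f_1 L1 L2 L3 m ((k - 1) * p) p + C * \<epsilon>\<^sup>2" if k: "k \<in> {1..s}" for k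
  proof -
    have Suc: "Suc (k - 1) = k" and "Suc (k - 1) \<le> s"
      using k by auto
    from eventually_orth_defect_Qhat[OF assms(1,3-8) this(2)]
    have "\<forall>\<^sub>F \<epsilon> in at_right 0. hyp \<epsilon> \<longrightarrow>
        norm2 (1\<^sub>m (k * p) - (Qhat (a \<epsilon>) p A k)\<^sup>T * Qhat (a \<epsilon>) p A k)
          \<le> \<epsilon> * f_1 L1 L2 L3 m ((k - 1) * p) p + 0 * \<epsilon>\<^sup>2"
      unfolding Suc
    proof eventually_elim
      case (elim \<epsilon>)
      show ?case
      proof
        assume "hyp \<epsilon>"
        then have "Qhat (a \<epsilon>) p A k \<in> carrier_mat m (k * p)"
          and "orth_defect (Qhat (a \<epsilon>) p A k) \<le> \<epsilon> * f_1 L1 L2 L3 m ((k - 1) * p) p"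
          using elim by (auto simp: hyp_def)
        then show "norm2 (1\<^sub>m (k * p) - (Qhat (a \<epsilon>) p A k)\<^sup>T * Qhat (a \<epsilon>) p A k)
            \<le> \<epsilon> * f_1 L1 L2 L3 m ((k - 1) * p) p + 0 * \<epsilon>\<^sup>2"
          by (simp add: orth_defect_def)
      qed
    qed
    then show ?thesis
      by blast
  qed
  then show ?thesis
    using main[of s] assms(2,3) by auto
qed

end
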